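(* For every $k\in\mathbb{Z}_{\ge0}$ there exist integers $m_\sigma\in\mathbb{Z}_{\ge0}$, indexed by $\sigma\in S_n$ with $1\le n\le k+1$ and $\ell(\sigma)\le k$, such that in $\mathrm{End}_{\mathcal H}(Q_+)$ \[ x^k=\sum_{n=1}^{k+1}\ \sum_{\substack{\sigma\in S_n\\ \ell(\sigma)\le k}} m_\sigma\,\mathrm{Tr}'\big(\varphi_n(\sigma)\big), \] and moreover $m_\sigma=0$ unless $\ell(\sigma)\equiv k\pmod 2$.
   Context: Khovanov's Heisenberg category $\mathcal{H}$ is the $\mathbb{C}$-linear strict monoidal category whose objects are finite direct sums of words $Q_\varepsilon=Q_{\varepsilon_1}\otimes\cdots\otimes Q_{\varepsilon_m}$, $\varepsilon_i\in\{+,-\}$ (empty word = unit $\mathbf1$). Morphisms $Q_\varepsilon\to Q_{\varepsilon'}$ are $\mathbb{C}$-linear combinations of isotopy classes (rel boundary) of planar oriented string diagrams with transversal crossings, bottom endpoints reading $\varepsilon$ and top endpoints reading $\varepsilon'$ ($+$ = strand oriented upward at that endpoint, $-$ = downward); composition is vertical stacking (source at bottom), $\otimes$ is horizontal juxtaposition (left factor on the left). Local relations: (1) two upward strands crossing twice equal two parallel upward strands; (2) braid relation for three upward strands; (3) on $Q_+\otimes Q_-$ the double crossing is the identity; (4) on $Q_-\otimes Q_+$ the double crossing equals the identity minus (cap $Q_-\otimes Q_+\to\mathbf 1$ followed by cup $\mathbf1\to Q_-\otimes Q_+$); (5) a counterclockwise circle equals $1$; (6) an upward strand with a curl on its left-hand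 side is $0$. The dot $x\in\mathrm{End}(Q_+)$ is the upward strand with a curl on its right-hand side, $x^k$ its $k$-fold composite. By relations (1),(2) there is an algebra homomorphism $\varphi_n\colon\mathbb{C}[S_n]\to\mathrm{End}(Q_+^{\otimes n})$ sending $s_i=(i\ i{+}1)$ to the crossing of the $i$-th and $(i{+}1)$-th upward strands. For $f\in\mathrm{End}(Q_+^{\otimes n})$, the partial closure $\mathrm{Tr}'(f)\in\mathrm{End}(Q_+)$ is obtained by leaving the leftmost (first) strand open and joining, for each $j=2,\dots,n$, the $j$-th top endpoint to the $j$-th bottom endpoint by an arc passing to the right of the diagram, arcs nested with the $n$-th innermost (so they are oriented clockwise); for $n=1$, $\mathrm{Tr}'(f)=f$. $\ell(\sigma)$ denotes the Coxeter length of $\sigma\in S_n$ (minimal number of simple transpositions $s_i$ needed to write $\sigma$). *)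

theory Defs
  imports Complex_Main "HOL-Library.Poly_Mapping" "HOL-Combinatorics.Permutations"
begin

subsection \<open>Planar oriented string diagrams\<close>

text \<open>
  A planar diagram in general position with respect to the height function is a finite stack of
  horizontal slices, each of which contains one crossing, one local minimum or one local maximum,
  with vertical strands to its left and to its right.  Stacks are listed from bottom to top.
\<close>

datatype orient = Up | Down

primrec opp :: "orient \<Rightarrow> orient" where
  "opp Up = Down"
| "opp Down = Up"

type_synonym word = "orient list"

text \<open>
  \<open>Cross a b\<close> has bottom endpoints \<open>a b\<close> and top endpoints \<open>b a\<close>.  The left leg of
  \<open>Cup a\<close> and of \<open>Cap a\<close> has orientation \<open>a\<close>, so arcs marked \<open>Up\<close> are clockwise and arcs
  marked \<open>Down\<close> are counterclockwise.
\<close>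

datatype gen = Cross orient orient | Cup orient | Cap orient

primrec gsrc :: "gen \<Rightarrow> word" where
  "gsrc (Cross a b) = [a, b]"
| "gsrc (Cup a) = []"
| "gsrc (Cap a) = [a, opp a]"

primrec gtgt :: "gen \<Rightarrow> word" where
  "gtgt (Cross a b) = [b, a]"
| "gtgt (Cup a) = [a, opp a]"
| "gtgt (Cap a) = []"

datatype slice = Slice word gen word

primrec ssrc :: "slice \<Rightarrow> word" where
  "ssrc (Slice l g r) = l @ gsrc g @ r"

primrec stgt :: "slice \<Rightarrow> word" where
  "stgt (Slice l g r) = l @ gtgt g @ r"

primrec whisker :: "word \<Rightarrow> word \<Rightarrow> slice \<Rightarrow> slice" where
  "whisker u v (Slice l g r) = Slice (u @ l) g (r @ v)"

primrec stack :: "slice list \<Rightarrow> word \<Rightarrow> word \<Rightarrow> bool" where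
  "stack [] u v \<longleftrightarrow> u = v"
| "stack (s # ss) u v \<longleftrightarrow> ssrc s = u \<and> stack ss (stgt s) v"

lemma stack_append: "stack ss u v \<Longrightarrow> stack ts v w \<Longrightarrow> stack (ss @ ts) u w"
  by (induction ss arbitrary: u) auto

lemma stack_whisker: "stack ss u v \<Longrightarrow> stack (map (whisker l r) ss) (l @ u @ r) (l @ v @ r)"
proof (induction ss arbitrary: u)
  case (Cons s ss)
  then show ?case using Cons.IH[of "stgt s"] by (cases s) auto
qed simp

typedef diagram = "{(u, ss, v). stack ss u v}"
  by (rule exI[of _ "([], [], [])"]) simp

setup_lifting type_definition_diagram

lift_definition dsrc :: "diagram \<Rightarrow> word" is "\<lambda>(u, ss, v). u" .

lift_definition dtgt :: "diagram \<Rightarrow> word" is "\<lambda>(u, ss, v). v" .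

lift_definition did :: "word \<Rightarrow> diagram" is "\<lambda>u. (u, [], u)" by simp

lift_definition dgen :: "gen \<Rightarrow> diagram" is "\<lambda>g. (gsrc g, [Slice [] g []], gtgt g)" by simp

text \<open>\<open>dcomp e d\<close> is \<open>e\<close> stacked on top of \<open>d\<close>; it is used for \<open>dtgt d = dsrc e\<close> only.\<close>

lift_definition dcomp :: "diagram \<Rightarrow> diagram \<Rightarrow> diagram"
  is "\<lambda>(u', ss', v') (u, ss, v). if v = u' then (u, ss @ ss', v') else ([], [], [])"
  by (auto simp: stack_append split: if_splits)

lift_definition dtensor :: "diagram \<Rightarrow> diagram \<Rightarrow> diagram"
  is "\<lambda>(u, ss, v) (u', ss', v').
        (u @ u', map (whisker [] u') ss @ map (whisker v []) ss', v @ v')"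
  by (auto intro!: stack_append dest: stack_whisker[where l = "[]"] stack_whisker[where r = "[]"])

lemma dsrc_simps [simp]:
  "dsrc (did u) = u" "dsrc (dgen g) = gsrc g"
  "dtgt d = dsrc e \<Longrightarrow> dsrc (dcomp e d) = dsrc d"
  "dsrc (dtensor d d') = dsrc d @ dsrc d'"
  by (transfer; auto)+

lemma dtgt_simps [simp]:
  "dtgt (did u) = u" "dtgt (dgen g) = gtgt g"
  "dtgt d = dsrc e \<Longrightarrow> dtgt (dcomp e d) = dtgt e"
  "dtgt (dtensor d d') = dtgt d @ dtgt d'"
  by (transfer; auto)+

subsection \<open>Isotopy rel boundary\<close>

text \<open>
  A generic isotopy changes the stack of slices only when two of the distinguished points pass
  through the same height (exchange), when a local maximum and a local minimum adjacent on a
  strand cancel or are created (zigzag), or when one of the two branches at a crossing becomes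
  horizontal, so that the crossing moves from one leg of a cap or cup to the other (slide).
\<close>

inductive isotopic :: "diagram \<Rightarrow> diagram \<Rightarrow> bool" where
  refl: "isotopic d d"
| sym: "isotopic d e \<Longrightarrow> isotopic e d"
| trans: "isotopic c d \<Longrightarrow> isotopic d e \<Longrightarrow> isotopic c e"
| comp: "isotopic d d' \<Longrightarrow> isotopic e e' \<Longrightarrow> dtgt d = dsrc e \<Longrightarrow> dtgt d' = dsrc e' \<Longrightarrow>
    isotopic (dcomp e d) (dcomp e' d')"
| tensor: "isotopic d d' \<Longrightarrow> isotopic e e' \<Longrightarrow> isotopic (dtensor d e) (dtensor d' e')"
| exchange: "isotopic
    (dcomp (dtensor (did (gtgt g @ w)) (dgen h)) (dtensor (dgen g) (did (w @ gsrc h))))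
    (dcomp (dtensor (dgen g) (did (w @ gtgt h))) (dtensor (did (gsrc g @ w)) (dgen h)))"
| zigzag_left: "isotopic
    (dcomp (dtensor (dgen (Cap a)) (did [a])) (dtensor (did [a]) (dgen (Cup (opp a)))))
    (did [a])"
| zigzag_right: "isotopic
    (dcomp (dtensor (did [a]) (dgen (Cap (opp a)))) (dtensor (dgen (Cup a)) (did [a])))
    (did [a])"
| slide_cap: "isotopic
    (dcomp (dtensor (did [b]) (dgen (Cap a))) (dtensor (dgen (Cross a b)) (did [opp a])))
    (dcomp (dtensor (dgen (Cap a)) (did [b])) (dtensor (did [a]) (dgen (Cross b (opp a)))))"
| slide_cup: "isotopic
    (dcomp (dtensor (dgen (Cross b a)) (did [opp a])) (dtensor (did [b]) (dgen (Cup a))))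
    (dcomp (dtensor (did [a]) (dgen (Cross (opp a) b))) (dtensor (dgen (Cup a)) (did [b])))"

lemma opp_opp [simp]: "opp (opp a) = a"
  by (cases a) auto

lemma isotopic_boundary: "isotopic d e \<Longrightarrow> dsrc d = dsrc e \<and> dtgt d = dtgt e"
  by (induction rule: isotopic.induct) auto

quotient_type diagram_class = diagram / isotopic
  by (intro equivpI reflpI sympI transpI) (blast intro: isotopic.intros)+

lift_definition src :: "diagram_class \<Rightarrow> word" is dsrc
  by (simp add: isotopic_boundary)

lift_definition tgt :: "diagram_class \<Rightarrow> word" is dtgt
  by (simp add: isotopic_boundary)

lift_definition cid :: "word \<Rightarrow> diagram_class" is did .

lift_definition cgen :: "gen \<Rightarrow> diagram_class" is dgen .

lemma dcomp_mismatch: "dtgt d \<noteq> dsrc e \<Longrightarrow> dcomp e d = did []"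
  by transfer auto

lift_definition ccomp :: "diagram_class \<Rightarrow> diagram_class \<Rightarrow> diagram_class" is dcomp
proof -
  fix e e' d d' assume *: "isotopic e e'" "isotopic d d'"
  show "isotopic (dcomp e d) (dcomp e' d')"
  proof (cases "dtgt d = dsrc e")
    case True
    then show ?thesis using * isotopic_boundary by (metis isotopic.comp)
  next
    case False
    then have "dtgt d' \<noteq> dsrc e'" using * isotopic_boundary by metis
    with False show ?thesis by (simp add: dcomp_mismatch isotopic.refl)
  qed
qed

lift_definition ctensor :: "diagram_class \<Rightarrow> diagram_class \<Rightarrow> diagram_class" is dtensor
  by (rule isotopic.tensor)

subsection \<open>Linear combinations of isotopy classes\<close>

type_synonym lin = "diagram_class \<Rightarrow>\<^sub>0 complex"

definition lscale :: "complex \<Rightarrow> ('a \<Rightarrow>\<^sub>0 complex) \<Rightarrow> ('a \<Rightarrow>\<^sub>0 complex)" where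
  "lscale c f = Poly_Mapping.map ((*) c) f"

definition lextend :: "('a \<Rightarrow> ('b \<Rightarrow>\<^sub>0 complex)) \<Rightarrow> ('a \<Rightarrow>\<^sub>0 complex) \<Rightarrow> ('b \<Rightarrow>\<^sub>0 complex)" where
  "lextend h f = (\<Sum>a\<in>Poly_Mapping.keys f. lscale (Poly_Mapping.lookup f a) (h a))"

definition lof :: "'a \<Rightarrow> ('a \<Rightarrow>\<^sub>0 complex)" where
  "lof d = Poly_Mapping.single d 1"

text \<open>
  The type \<^typ>\<open>lin\<close> is the direct sum of the spaces of linear combinations over all pairs of
  boundary words; the product of two classes which cannot be stacked is \<open>0\<close>.
\<close>

definition lcomp :: "lin \<Rightarrow> lin \<Rightarrow> lin" (infixr \<open>\<circ>\<^sub>L\<close> 70) where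
  "f \<circ>\<^sub>L g = lextend (\<lambda>e. lextend (\<lambda>d. if tgt d = src e then lof (ccomp e d) else 0) g) f"

definition ltensor :: "lin \<Rightarrow> lin \<Rightarrow> lin" (infixr \<open>\<otimes>\<^sub>L\<close> 75) where
  "f \<otimes>\<^sub>L g = lextend (\<lambda>d. lextend (\<lambda>e. lof (ctensor d e)) g) f"

abbreviation lid :: "word \<Rightarrow> lin" where
  "lid u \<equiv> lof (cid u)"

abbreviation lgen :: "gen \<Rightarrow> lin" where
  "lgen g \<equiv> lof (cgen g)"

lemma lookup_lscale: "Poly_Mapping.lookup (lscale c f) a = c * Poly_Mapping.lookup f a"
  by (auto simp: lscale_def map.rep_eq when_def)

lemma lscale_simps [simp]:
  "lscale c (0 :: 'a \<Rightarrow>\<^sub>0 complex) = 0" "lscale 0 f = 0" "lscale 1 f = f" "lscale (- 1) f = - f"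
  by (auto intro!: poly_mapping_eqI simp: lookup_lscale)

lemma lscale_add_right: "lscale c (f + g) = lscale c f + lscale c g"
  by (auto intro!: poly_mapping_eqI simp: lookup_lscale lookup_add algebra_simps)

lemma lscale_diff_right: "lscale c (f - g) = lscale c f - lscale c g"
  by (rule poly_mapping_eqI) (simp add: lookup_lscale lookup_minus right_diff_distrib)

lemma lscale_add_left: "lscale (b + c) f = lscale b f + lscale c f"
  by (auto intro!: poly_mapping_eqI simp: lookup_lscale lookup_add algebra_simps)

lemma lscale_lscale: "lscale b (lscale c f) = lscale (b * c) f"
  by (auto intro!: poly_mapping_eqI simp: lookup_lscale)

lemma lscale_sum: "lscale c (sum h A) = (\<Sum>a\<in>A. lscale c (h a))"
  by (induction A rule: infinite_finite_induct) (auto simp: lscale_add_right)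

lemma lextend_superset:
  assumes "finite A" "Poly_Mapping.keys f \<subseteq> A"
  shows "lextend h f = (\<Sum>a\<in>A. lscale (Poly_Mapping.lookup f a) (h a))"
  unfolding lextend_def using assms by (intro sum.mono_neutral_left) (auto simp: in_keys_iff)

lemma lextend_add: "lextend h (f + g) = lextend h f + lextend h g"
proof -
  let ?A = "Poly_Mapping.keys f \<union> Poly_Mapping.keys g"
  have "Poly_Mapping.keys (f + g) \<subseteq> ?A" by (rule keys_add)
  then show ?thesis
    by (simp add: lextend_superset[of ?A] lookup_add lscale_add_left sum.distrib)
qed

lemma lextend_lscale: "lextend h (lscale c f) = lscale c (lextend h f)"
proof -
  have "Poly_Mapping.keys (lscale c f) \<subseteq> Poly_Mapping.keys f"
    by (auto simp: in_keys_iff lookup_lscale)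
  then show ?thesis
    by (simp add: lextend_superset[of "Poly_Mapping.keys f"] lookup_lscale lscale_sum lscale_lscale)
qed

lemma lextend_diff: "lextend h (f - g) = lextend h f - lextend h g"
  using lextend_add[of h f "lscale (- 1) g"] by (simp only: lextend_lscale) simp

lemma lextend_fun_diff: "lextend (\<lambda>a. h a - h' a) f = lextend h f - lextend h' f"
  by (simp add: lextend_def lscale_diff_right sum_subtractf)

lemma lcomp_diff_left: "(f - f') \<circ>\<^sub>L g = f \<circ>\<^sub>L g - f' \<circ>\<^sub>L g"
  by (simp add: lcomp_def lextend_diff)

lemma lcomp_diff_right: "f \<circ>\<^sub>L (g - g') = f \<circ>\<^sub>L g - f \<circ>\<^sub>L g'"
  by (simp add: lcomp_def lextend_diff lextend_fun_diff)

lemma ltensor_diff_left: "(f - f') \<otimes>\<^sub>L g = f \<otimes>\<^sub>L g - f' \<otimes>\<^sub>L g"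
  by (simp add: ltensor_def lextend_diff)

lemma ltensor_diff_right: "f \<otimes>\<^sub>L (g - g') = f \<otimes>\<^sub>L g - f \<otimes>\<^sub>L g'"
  by (simp add: ltensor_def lextend_diff lextend_fun_diff)

subsection \<open>The local relations\<close>

inductive_set local_rel :: "lin set" where
  double_up:
    "lgen (Cross Up Up) \<circ>\<^sub>L lgen (Cross Up Up) - lid [Up, Up] \<in> local_rel"
| braid_up:
    "(lgen (Cross Up Up) \<otimes>\<^sub>L lid [Up]) \<circ>\<^sub>L (lid [Up] \<otimes>\<^sub>L lgen (Cross Up Up)) \<circ>\<^sub>L
       (lgen (Cross Up Up) \<otimes>\<^sub>L lid [Up]) -
     (lid [Up] \<otimes>\<^sub>L lgen (Cross Up Up)) \<circ>\<^sub>L (lgen (Cross Up Up) \<otimes>\<^sub>L lid [Up]) \<circ>\<^sub>L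
       (lid [Up] \<otimes>\<^sub>L lgen (Cross Up Up)) \<in> local_rel"
| double_up_down:
    "lgen (Cross Down Up) \<circ>\<^sub>L lgen (Cross Up Down) - lid [Up, Down] \<in> local_rel"
| double_down_up:
    "lgen (Cross Up Down) \<circ>\<^sub>L lgen (Cross Down Up) -
     (lid [Down, Up] - lgen (Cup Down) \<circ>\<^sub>L lgen (Cap Down)) \<in> local_rel"
| counterclockwise_circle:
    "lgen (Cap Down) \<circ>\<^sub>L lgen (Cup Down) - lid [] \<in> local_rel"
| left_curl:
    "(lgen (Cap Down) \<otimes>\<^sub>L lid [Up]) \<circ>\<^sub>L (lid [Down] \<otimes>\<^sub>L lgen (Cross Up Up)) \<circ>\<^sub>L
       (lgen (Cup Down) \<otimes>\<^sub>L lid [Up]) \<in> local_rel"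

inductive_set heis_ideal :: "lin set" where
  base: "f \<in> local_rel \<Longrightarrow> f \<in> heis_ideal"
| zero: "0 \<in> heis_ideal"
| add: "f \<in> heis_ideal \<Longrightarrow> g \<in> heis_ideal \<Longrightarrow> f + g \<in> heis_ideal"
| scale: "f \<in> heis_ideal \<Longrightarrow> lscale c f \<in> heis_ideal"
| comp_left: "f \<in> heis_ideal \<Longrightarrow> g \<circ>\<^sub>L f \<in> heis_ideal"
| comp_right: "f \<in> heis_ideal \<Longrightarrow> f \<circ>\<^sub>L g \<in> heis_ideal"
| tensor_left: "f \<in> heis_ideal \<Longrightarrow> g \<otimes>\<^sub>L f \<in> heis_ideal"
| tensor_right: "f \<in> heis_ideal \<Longrightarrow> f \<otimes>\<^sub>L g \<in> heis_ideal"

lemma heis_ideal_uminus: "f \<in> heis_ideal \<Longrightarrow> - f \<in> heis_ideal"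
  using heis_ideal.scale[of f "- 1"] by simp

lemma heis_ideal_diff: "f \<in> heis_ideal \<Longrightarrow> g \<in> heis_ideal \<Longrightarrow> f - g \<in> heis_ideal"
  using heis_ideal.add[of f "- g"] heis_ideal_uminus[of g] by simp

subsection \<open>Morphisms of the Heisenberg category\<close>

text \<open>
  The ideal is spanned by elements that are homogeneous for the two boundary words.  So this type
  is the direct sum over all pairs of words \<open>u\<close>, \<open>v\<close> of the spaces of morphisms from \<open>u\<close> to \<open>v\<close>,
  and an equation between morphisms from \<open>u\<close> to \<open>v\<close> holds here iff it holds in that summand.
\<close>

quotient_type heis = lin / "\<lambda>f g. f - g \<in> heis_ideal"
proof (intro equivpI reflpI sympI transpI)
  fix f g h :: lin
  show "f - f \<in> heis_ideal" by (simp add: heis_ideal.zero)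
  show "g - f \<in> heis_ideal" if "f - g \<in> heis_ideal"
    using heis_ideal_uminus[OF that] by simp
  show "f - h \<in> heis_ideal" if "f - g \<in> heis_ideal" "g - h \<in> heis_ideal"
    using heis_ideal.add[OF that] by simp
qed

instantiation heis :: ab_group_add
begin

lift_definition zero_heis :: heis is 0 .

lift_definition plus_heis :: "heis \<Rightarrow> heis \<Rightarrow> heis" is "(+)"
  by (metis add_diff_add heis_ideal.add)

lift_definition minus_heis :: "heis \<Rightarrow> heis \<Rightarrow> heis" is "(-)"
proof -
  fix f f' g g' :: lin assume *: "f - f' \<in> heis_ideal" "g - g' \<in> heis_ideal"
  have "f - g - (f' - g') = (f - f') - (g - g')" by simp
  then show "f - g - (f' - g') \<in> heis_ideal" using heis_ideal_diff[OF *] by argo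
qed

lift_definition uminus_heis :: "heis \<Rightarrow> heis" is uminus
proof -
  fix f g :: lin assume "f - g \<in> heis_ideal"
  moreover have "- f - - g = - (f - g)" by simp
  ultimately show "- f - - g \<in> heis_ideal" using heis_ideal_uminus by metis
qed

instance
proof
  fix a b c :: heis
  show "a + b + c = a + (b + c)" by transfer (simp add: heis_ideal.zero algebra_simps)
  show "a + b = b + a" by transfer (simp add: heis_ideal.zero algebra_simps)
  show "0 + a = a" by transfer (simp add: heis_ideal.zero)
  show "- a + a = 0" by transfer (simp add: heis_ideal.zero)
  show "a - b = a + - b" by transfer (simp add: heis_ideal.zero)
qed

end

lift_definition hscale :: "complex \<Rightarrow> heis \<Rightarrow> heis" (infixr \<open>*\<^sub>H\<close> 70) is lscale
  by (metis lscale_diff_right heis_ideal.scale)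

lift_definition hcomp :: "heis \<Rightarrow> heis \<Rightarrow> heis" (infixr \<open>\<circ>\<^sub>H\<close> 72) is lcomp
proof -
  fix f f' g g' assume *: "f - f' \<in> heis_ideal" "g - g' \<in> heis_ideal"
  have "f \<circ>\<^sub>L g - f' \<circ>\<^sub>L g' = (f - f') \<circ>\<^sub>L g + f' \<circ>\<^sub>L (g - g')"
    by (simp add: lcomp_diff_left lcomp_diff_right)
  then show "f \<circ>\<^sub>L g - f' \<circ>\<^sub>L g' \<in> heis_ideal"
    using * by (simp add: heis_ideal.add heis_ideal.comp_left heis_ideal.comp_right)
qed

lift_definition htensor :: "heis \<Rightarrow> heis \<Rightarrow> heis" (infixr \<open>\<otimes>\<^sub>H\<close> 75) is ltensor
proof -
  fix f f' g g' assume *: "f - f' \<in> heis_ideal" "g - g' \<in> heis_ideal"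
  have "f \<otimes>\<^sub>L g - f' \<otimes>\<^sub>L g' = (f - f') \<otimes>\<^sub>L g + f' \<otimes>\<^sub>L (g - g')"
    by (simp add: ltensor_diff_left ltensor_diff_right)
  then show "f \<otimes>\<^sub>L g - f' \<otimes>\<^sub>L g' \<in> heis_ideal"
    using * by (simp add: heis_ideal.add heis_ideal.tensor_left heis_ideal.tensor_right)
qed

lift_definition hid :: "word \<Rightarrow> heis" is lid .

lift_definition hgen :: "gen \<Rightarrow> heis" is lgen .

definition ups :: "nat \<Rightarrow> word" where
  "ups n = replicate n Up"

definition downs :: "nat \<Rightarrow> word" where
  "downs n = replicate n Down"

subsection \<open>The dot\<close>

definition dot :: heis where
  "dot = (hid [Up] \<otimes>\<^sub>H hgen (Cap Up)) \<circ>\<^sub>H (hgen (Cross Up Up) \<otimes>\<^sub>H hid [Down]) \<circ>\<^sub>H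
         (hid [Up] \<otimes>\<^sub>H hgen (Cup Up))"

primrec dot_power :: "nat \<Rightarrow> heis" where
  "dot_power 0 = hid [Up]"
| "dot_power (Suc k) = dot \<circ>\<^sub>H dot_power k"

subsection \<open>The homomorphism from the symmetric group and Coxeter length\<close>

text \<open>Elements of the symmetric group \<open>S\<^sub>n\<close> are the functions permuting \<open>{1..n}\<close>; words in the
  simple transpositions are lists over \<open>{1..<n}\<close>.\<close>

definition word_perm :: "nat list \<Rightarrow> nat \<Rightarrow> nat" where
  "word_perm w = foldr (\<lambda>i p. transpose i (Suc i) \<circ> p) w id"

definition coxeter_length :: "nat \<Rightarrow> (nat \<Rightarrow> nat) \<Rightarrow> nat" where
  "coxeter_length n \<sigma> =
     (LEAST r. \<exists>w. set w \<subseteq> {1..<n} \<and> word_perm w = \<sigma> \<and> length w = r)"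

definition crossing_at :: "nat \<Rightarrow> nat \<Rightarrow> heis" where
  "crossing_at n i = hid (ups (i - 1)) \<otimes>\<^sub>H hgen (Cross Up Up) \<otimes>\<^sub>H hid (ups (n - i - 1))"

definition word_crossings :: "nat \<Rightarrow> nat list \<Rightarrow> heis" where
  "word_crossings n w = foldr (\<lambda>i f. crossing_at n i \<circ>\<^sub>H f) w (hid (ups n))"

text \<open>
  The relations \<open>double_up\<close>, \<open>braid_up\<close> and the exchange of distant crossings are the Coxeter
  relations of \<open>S\<^sub>n\<close>, so the value does not depend on the word that is chosen for the permutation.
\<close>

definition phi :: "nat \<Rightarrow> (nat \<Rightarrow> nat) \<Rightarrow> heis" where
  "phi n \<sigma> = word_crossings n (SOME w. set w \<subseteq> {1..<n} \<and> word_perm w = \<sigma>)"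

subsection \<open>Partial closure to the right\<close>

primrec nested_cups :: "nat \<Rightarrow> heis" where
  "nested_cups 0 = hid []"
| "nested_cups (Suc m) = (hid [Up] \<otimes>\<^sub>H nested_cups m \<otimes>\<^sub>H hid [Down]) \<circ>\<^sub>H hgen (Cup Up)"

primrec nested_caps :: "nat \<Rightarrow> heis" where
  "nested_caps 0 = hid []"
| "nested_caps (Suc m) = hgen (Cap Up) \<circ>\<^sub>H (hid [Up] \<otimes>\<^sub>H nested_caps m \<otimes>\<^sub>H hid [Down])"

definition partial_closure :: "nat \<Rightarrow> heis \<Rightarrow> heis" where
  "partial_closure n f =
     (hid [Up] \<otimes>\<^sub>H nested_caps (n - 1)) \<circ>\<^sub>H (f \<otimes>\<^sub>H hid (downs (n - 1))) \<circ>\<^sub>H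
     (hid [Up] \<otimes>\<^sub>H nested_cups (n - 1))"

end

theory Submission
  imports Defs
begin

text \<open>
  Write \<open>x\<^sub>i\<close> for a dot on the \<open>i\<close>-th of \<open>n\<close> upward strands.  Relation (4) and the braid relation
  give \<open>x\<^sub>i = s\<^sub>i x\<^sub>i\<^sub>+\<^sub>1 s\<^sub>i + s\<^sub>i\<close>, hence \<open>x\<^sub>1 = (1 2) + \<dots> + (1 n) + c x\<^sub>n c\<inverse>\<close> with
  \<open>c = s\<^sub>1 \<dots> s\<^sub>n\<^sub>-\<^sub>1\<close>.  The dot on the last strand is a partial closure of the crossing \<open>s\<^sub>n\<close>, so
  \<open>x Tr'(\<sigma>)\<close> is the sum of the \<open>Tr'((1 i) \<sigma>)\<close> for \<open>2 \<le> i \<le> n + 1\<close>, the last of them taken on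
  \<open>n + 1\<close> strands.  By induction \<open>x\<^sup>k\<close> is a sum of closures of products of \<open>k\<close> transpositions.
  Closures are invariant under conjugation by permutations fixing \<open>1\<close>, and such a conjugation turns
  a product of \<open>k\<close> transpositions into an element of Coxeter length at most \<open>k\<close>; the parity
  statement is the multiplicativity of the sign.
\<close>

subsection \<open>Morphisms given by lists of slices\<close>

lemma lextend_lof: "lextend h (lof d) = h d"
  by (simp add: lextend_def lof_def)

lemma lcomp_lof: "lof e \<circ>\<^sub>L lof d = (if tgt d = src e then lof (ccomp e d) else 0)"
  by (simp add: lcomp_def lextend_lof)

lemma ltensor_lof: "lof d \<otimes>\<^sub>L lof e = lof (ctensor d e)"
  by (simp add: ltensor_def lextend_lof)

lemma lextend_fun_add: "lextend (\<lambda>a. h a + h' a) f = lextend h f + lextend h' f"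
  by (simp add: lextend_def lscale_add_right sum.distrib)

lemma hcomp_add_right: "f \<circ>\<^sub>H (g + h) = f \<circ>\<^sub>H g + f \<circ>\<^sub>H h"
  by transfer (simp add: lcomp_def lextend_add lextend_fun_add heis_ideal.zero)

lemma hcomp_add_left: "(f + g) \<circ>\<^sub>H h = f \<circ>\<^sub>H h + g \<circ>\<^sub>H h"
  by transfer (simp add: lcomp_def lextend_add heis_ideal.zero)

lemma htensor_add_right: "f \<otimes>\<^sub>H (g + h) = f \<otimes>\<^sub>H g + f \<otimes>\<^sub>H h"
  by transfer (simp add: ltensor_def lextend_add lextend_fun_add heis_ideal.zero)

lemma htensor_add_left: "(f + g) \<otimes>\<^sub>H h = f \<otimes>\<^sub>H h + g \<otimes>\<^sub>H h"
  by transfer (simp add: ltensor_def lextend_add heis_ideal.zero)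

lemma hcomp_zero_right: "f \<circ>\<^sub>H 0 = 0"
  using hcomp_add_right[of f 0 0] by simp

lemma hscale_add_left: "(b + c) *\<^sub>H f = b *\<^sub>H f + c *\<^sub>H f"
  by transfer (simp add: lscale_add_left heis_ideal.zero)

lemma hscale_zero_left: "0 *\<^sub>H f = 0"
  using hscale_add_left[of 0 0 f] by simp

lemma hscale_one: "1 *\<^sub>H f = f"
  by transfer (simp add: heis_ideal.zero)

text \<open>\<open>Abs_diagram\<close> is specified only on triples whose slices fit together, hence
  the \<open>stack\<close> hypotheses in the rules for \<open>diag\<close>.\<close>

definition diag :: "word \<Rightarrow> slice list \<Rightarrow> word \<Rightarrow> diagram" where
  "diag u ss v = Abs_diagram (u, ss, v)"

lemma Rep_diag: "stack ss u v \<Longrightarrow> Rep_diagram (diag u ss v) = (u, ss, v)"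
  by (simp add: diag_def Abs_diagram_inverse)

lemma did_diag: "did u = diag u [] u"
  by (rule iffD1[OF Rep_diagram_inject]) (simp add: Rep_diag did.rep_eq)

lemma dgen_diag: "dgen g = diag (gsrc g) [Slice [] g []] (gtgt g)"
  by (rule iffD1[OF Rep_diagram_inject]) (simp add: Rep_diag dgen.rep_eq)

lemma dcomp_diag:
  "stack ss u v \<Longrightarrow> stack ts v w \<Longrightarrow> dcomp (diag v ts w) (diag u ss v) = diag u (ss @ ts) w"
  by (rule iffD1[OF Rep_diagram_inject]) (simp add: Rep_diag dcomp.rep_eq stack_append)

lemma stack_tensor:
  "stack ss u v \<Longrightarrow> stack ts u' v' \<Longrightarrow>
   stack (map (whisker [] u') ss @ map (whisker v []) ts) (u @ u') (v @ v')"
  by (intro stack_append)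
     (auto dest: stack_whisker[where l = "[]"] stack_whisker[where r = "[]"])

lemma dtensor_diag:
  "stack ss u v \<Longrightarrow> stack ts u' v' \<Longrightarrow> dtensor (diag u ss v) (diag u' ts v') =
   diag (u @ u') (map (whisker [] u') ss @ map (whisker v []) ts) (v @ v')"
  by (rule iffD1[OF Rep_diagram_inject]) (simp add: Rep_diag dtensor.rep_eq stack_tensor)

lemma dsrc_diag: "stack ss u v \<Longrightarrow> dsrc (diag u ss v) = u"
  and dtgt_diag: "stack ss u v \<Longrightarrow> dtgt (diag u ss v) = v"
  by (simp_all add: dsrc.rep_eq dtgt.rep_eq Rep_diag)

definition mor :: "word \<Rightarrow> slice list \<Rightarrow> word \<Rightarrow> heis" where
  "mor u ss v = abs_heis (lof (abs_diagram_class (diag u ss v)))"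

lemma hid_mor: "hid u = mor u [] u"
  by (simp add: mor_def hid_def cid_def did_diag)

lemma hgen_mor: "hgen g = mor (gsrc g) [Slice [] g []] (gtgt g)"
  by (simp add: mor_def hgen_def cgen_def dgen_diag)

lemma mor_comp:
  "stack ss u v \<Longrightarrow> stack ts v w \<Longrightarrow> mor v ts w \<circ>\<^sub>H mor u ss v = mor u (ss @ ts) w"
  by (simp add: mor_def hcomp.abs_eq lcomp_lof src.abs_eq tgt.abs_eq dsrc_diag dtgt_diag
      ccomp.abs_eq dcomp_diag)

lemma mor_tensor:
  "stack ss u v \<Longrightarrow> stack ts u' v' \<Longrightarrow> mor u ss v \<otimes>\<^sub>H mor u' ts v' =
   mor (u @ u') (map (whisker [] u') ss @ map (whisker v []) ts) (v @ v')"
  by (simp add: mor_def htensor.abs_eq ltensor_lof ctensor.abs_eq dtensor_diag)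

lemma whisker_whisker: "whisker l r (whisker l' r' s) = whisker (l @ l') (r' @ r) s"
  by (cases s) simp

lemma map_whisker_whisker:
  "map (whisker l r) (map (whisker l' r') ss) = map (whisker (l @ l') (r' @ r)) ss"
  by (simp add: whisker_whisker)

text \<open>Tensoring with identity strands carries a local equation into a larger diagram, as in
  \<open>heq_whisker\<close> and \<open>mor_skein\<close>.\<close>

lemma mor_whisker:
  "stack ss u v \<Longrightarrow>
   mor (l @ u @ r) (map (whisker l r) ss) (l @ v @ r) = hid l \<otimes>\<^sub>H mor u ss v \<otimes>\<^sub>H hid r"
  using stack_whisker[of ss u v "[]" r]
  by (simp add: hid_mor mor_tensor map_whisker_whisker o_def whisker_whisker)

lemma mor_isotopic: "isotopic (diag u ss v) (diag u ts v) \<Longrightarrow> mor u ss v = mor u ts v"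
  unfolding mor_def by (metis diagram_class.abs_eq_iff)

text \<open>\<open>mor u ss v\<close> is a junk value unless \<open>stack ss u v\<close> holds.  With this condition built in, the
  relation \<open>heq\<close> is a congruence for stacking and whiskering, so that computations in the category
  become rewriting of lists of slices.\<close>

definition heq :: "word \<Rightarrow> word \<Rightarrow> slice list \<Rightarrow> slice list \<Rightarrow> bool" where
  "heq u v ss ts \<longleftrightarrow> stack ss u v \<and> stack ts u v \<and> mor u ss v = mor u ts v"

lemma heq_refl: "stack ss u v \<Longrightarrow> heq u v ss ss"
  by (simp add: heq_def)

lemma heq_sym: "heq u v ss ts \<Longrightarrow> heq u v ts ss"
  by (simp add: heq_def)

lemma heq_trans [trans]: "heq u v ss ts \<Longrightarrow> heq u v ts us \<Longrightarrow> heq u v ss us"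
  by (simp add: heq_def)

lemma heq_append: "heq u v ss ts \<Longrightarrow> heq v w ss' ts' \<Longrightarrow> heq u w (ss @ ss') (ts @ ts')"
  unfolding heq_def by (metis mor_comp stack_append)

lemma heq_whisker:
  "heq u v ss ts \<Longrightarrow> heq (l @ u @ r) (l @ v @ r) (map (whisker l r) ss) (map (whisker l r) ts)"
  by (simp add: heq_def stack_whisker mor_whisker)

lemma heq_middle:
  assumes "heq a b ss ts" "stack xs u a" "stack ys b v"
  shows "heq u v (xs @ ss @ ys) (xs @ ts @ ys)"
  using assms by (meson heq_append heq_refl)

lemma heq_append_left: "stack xs u v \<Longrightarrow> heq v w ss ts \<Longrightarrow> heq u w (xs @ ss) (xs @ ts)"
  by (meson heq_append heq_refl)

lemma heq_append_right: "heq u v ss ts \<Longrightarrow> stack ys v w \<Longrightarrow> heq u w (ss @ ys) (ts @ ys)"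
  by (meson heq_append heq_refl)

lemma heq_isotopic:
  "isotopic (diag u ss v) (diag u ts v) \<Longrightarrow> stack ss u v \<Longrightarrow> stack ts u v \<Longrightarrow> heq u v ss ts"
  by (simp add: heq_def mor_isotopic)

section \<open>Isotopy moves as rewriting rules for stacks\<close>

lemmas diag_simps = did_diag dgen_diag dcomp_diag dtensor_diag

lemma heq_exchange0:
  "heq (gsrc g @ w @ gsrc h) (gtgt g @ w @ gtgt h)
     [Slice [] g (w @ gsrc h), Slice (gtgt g @ w) h []]
     [Slice (gsrc g @ w) h [], Slice [] g (w @ gtgt h)]"
  using isotopic.exchange[of g w h] by (intro heq_isotopic) (simp_all add: diag_simps)

lemma heq_exchange:
  "heq (l @ gsrc g @ w @ gsrc h @ r) (l @ gtgt g @ w @ gtgt h @ r)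
     [Slice l g (w @ gsrc h @ r), Slice (l @ gtgt g @ w) h r]
     [Slice (l @ gsrc g @ w) h r, Slice l g (w @ gtgt h @ r)]"
  using heq_whisker[OF heq_exchange0, of l g w h r] by simp

lemma heq_zigzag_left: "heq [a] [a] [Slice [a] (Cup (opp a)) [], Slice [] (Cap a) [a]] []"
  using isotopic.zigzag_left[of a] by (intro heq_isotopic) (simp_all add: diag_simps)

lemma heq_zigzag_right: "heq [a] [a] [Slice [] (Cup a) [a], Slice [a] (Cap (opp a)) []] []"
  using isotopic.zigzag_right[of a] by (intro heq_isotopic) (simp_all add: diag_simps)

lemma heq_slide_cap:
  "heq [a, b, opp a] [b]
     [Slice [] (Cross a b) [opp a], Slice [b] (Cap a) []]
     [Slice [a] (Cross b (opp a)) [], Slice [] (Cap a) [b]]"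
  using isotopic.slide_cap[of b a] by (intro heq_isotopic) (simp_all add: diag_simps)

lemma heq_slide_cup:
  "heq [b] [a, b, opp a]
     [Slice [b] (Cup a) [], Slice [] (Cross b a) [opp a]]
     [Slice [] (Cup a) [b], Slice [a] (Cross (opp a) b) []]"
  using isotopic.slide_cup[of b a] by (intro heq_isotopic) (simp_all add: diag_simps)

section \<open>Local relations as rules for stacks\<close>

lemma heis_eqI: "f - g \<in> heis_ideal \<Longrightarrow> abs_heis f = abs_heis g"
  by (simp add: heis.abs_eq_iff)

lemma heq_double_up:
  "heq [Up, Up] [Up, Up] [Slice [] (Cross Up Up) [], Slice [] (Cross Up Up) []] []"
proof -
  have "hgen (Cross Up Up) \<circ>\<^sub>H hgen (Cross Up Up) = hid [Up, Up]"
    unfolding hgen_def hid_def map_fun_def o_def id_def hcomp.abs_eq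
    by (rule heis_eqI[OF heis_ideal.base[OF local_rel.double_up]])
  then show ?thesis by (simp add: heq_def hgen_mor hid_mor mor_comp)
qed

lemma heq_braid_up:
  "heq [Up, Up, Up] [Up, Up, Up]
     [Slice [] (Cross Up Up) [Up], Slice [Up] (Cross Up Up) [], Slice [] (Cross Up Up) [Up]]
     [Slice [Up] (Cross Up Up) [], Slice [] (Cross Up Up) [Up], Slice [Up] (Cross Up Up) []]"
proof -
  let ?X = "hgen (Cross Up Up)"
  have "(?X \<otimes>\<^sub>H hid [Up]) \<circ>\<^sub>H (hid [Up] \<otimes>\<^sub>H ?X) \<circ>\<^sub>H (?X \<otimes>\<^sub>H hid [Up]) =
        (hid [Up] \<otimes>\<^sub>H ?X) \<circ>\<^sub>H (?X \<otimes>\<^sub>H hid [Up]) \<circ>\<^sub>H (hid [Up] \<otimes>\<^sub>H ?X)"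
    unfolding hgen_def hid_def map_fun_def o_def id_def hcomp.abs_eq htensor.abs_eq
    by (rule heis_eqI[OF heis_ideal.base[OF local_rel.braid_up]])
  then show ?thesis by (simp add: heq_def hgen_mor hid_mor mor_comp mor_tensor)
qed

text \<open>Relation (4), solved for the identity because it serves to insert slices between a
  downward and an upward strand. With two terms on the right it is not an instance of
  \<open>heq\<close>.\<close>

lemma mor_double_down_up:
  "mor [Down, Up] [] [Down, Up] =
   mor [Down, Up] [Slice [] (Cross Down Up) [], Slice [] (Cross Up Down) []] [Down, Up] +
   mor [Down, Up] [Slice [] (Cap Down) [], Slice [] (Cup Down) []] [Down, Up]"
proof -
  have "hgen (Cross Up Down) \<circ>\<^sub>H hgen (Cross Down Up) =
        hid [Down, Up] - hgen (Cup Down) \<circ>\<^sub>H hgen (Cap Down)"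
    unfolding hgen_def hid_def map_fun_def o_def id_def hcomp.abs_eq minus_heis.abs_eq
    by (rule heis_eqI[OF heis_ideal.base[OF local_rel.double_down_up]])
  then show ?thesis by (simp add: hgen_mor hid_mor mor_comp)
qed

text \<open>Bilinearity allows relation (4) anywhere inside a stack.\<close>

lemma mor_skein:
  assumes "stack xs u (l @ [Down, Up] @ r)" "stack ys (l @ [Down, Up] @ r) v"
  shows "mor u (xs @ ys) v =
    mor u (xs @ [Slice l (Cross Down Up) r, Slice l (Cross Up Down) r] @ ys) v +
    mor u (xs @ [Slice l (Cap Down) r, Slice l (Cup Down) r] @ ys) v"
proof -
  let ?w = "l @ [Down, Up] @ r"
  let ?A = "[Slice l (Cross Down Up) r, Slice l (Cross Up Down) r]"
  let ?B = "[Slice l (Cap Down) r, Slice l (Cup Down) r]"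
  have "hid l \<otimes>\<^sub>H mor [Down, Up] [] [Down, Up] \<otimes>\<^sub>H hid r =
    hid l \<otimes>\<^sub>H mor [Down, Up] [Slice [] (Cross Down Up) [], Slice [] (Cross Up Down) []] [Down, Up]
      \<otimes>\<^sub>H hid r +
    hid l \<otimes>\<^sub>H mor [Down, Up] [Slice [] (Cap Down) [], Slice [] (Cup Down) []] [Down, Up] \<otimes>\<^sub>H hid r"
    by (subst mor_double_down_up) (simp only: htensor_add_left htensor_add_right)
  then have "mor ?w [] ?w = mor ?w ?A ?w + mor ?w ?B ?w"
    by (simp flip: mor_whisker)
  then have "mor ?w ys v \<circ>\<^sub>H mor ?w [] ?w \<circ>\<^sub>H mor u xs ?w =
     mor ?w ys v \<circ>\<^sub>H mor ?w ?A ?w \<circ>\<^sub>H mor u xs ?w + mor ?w ys v \<circ>\<^sub>H mor ?w ?B ?w \<circ>\<^sub>H mor u xs ?w"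
    by (simp only: hcomp_add_left hcomp_add_right)
  moreover have "mor ?w ys v \<circ>\<^sub>H mor ?w zs ?w \<circ>\<^sub>H mor u xs ?w = mor u (xs @ zs @ ys) v"
    if "stack zs ?w ?w" for zs
    using that assms by (simp add: mor_comp stack_append)
  ultimately show ?thesis by simp
qed

text \<open>The interchange law for whole stacks: diagrams side by side can be drawn in either order
  of height. Two nested inductions reduce it to single slices.\<close>

lemma heq_exchange_slices:
  assumes "stack ss a b" "stack ts c d"
  shows "heq (a @ w @ c) (b @ w @ d)
    (map (whisker [] (w @ c)) ss @ map (whisker (b @ w) []) ts)
    (map (whisker (a @ w) []) ts @ map (whisker [] (w @ d)) ss)"
  using assms(1)
proof (induction ss arbitrary: a)
  case Nil
  then show ?case using stack_whisker[OF assms(2), of "a @ w" "[]"] by (simp add: heq_refl)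
next
  case (Cons s ss)
  obtain l g r where s: "s = Slice l g r" by (cases s)
  have st: "stack ss (l @ gtgt g @ r) b" and a: "a = l @ gsrc g @ r" using Cons.prems s by auto
  \<comment> \<open>The inner induction raises the single slice \<open>s\<close> above all of
    \<open>ts\<close>.\<close>
  have one: "heq (a @ w @ c) (stgt s @ w @ d)
     (whisker [] (w @ c) s # map (whisker (stgt s @ w) []) ts)
     (map (whisker (a @ w) []) ts @ [whisker [] (w @ d) s])"
    using assms(2)
  proof (induction ts arbitrary: c)
    case Nil
    then show ?case by (simp add: heq_refl s a)
  next
    case (Cons t ts)
    obtain l' h r' where t: "t = Slice l' h r'" by (cases t)
    let ?T = "map (whisker (stgt s @ w) []) ts"
    from Cons.prems t have c: "c = l' @ gsrc h @ r'" and st': "stack ts (l' @ gtgt h @ r') d" by auto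
    have "heq (a @ w @ c) (stgt s @ w @ d)
       ([Slice l g ((r @ w @ l') @ gsrc h @ r'), Slice (l @ gtgt g @ r @ w @ l') h r'] @ ?T)
       ([Slice (l @ gsrc g @ r @ w @ l') h r', Slice l g ((r @ w @ l') @ gtgt h @ r')] @ ?T)"
      using heq_exchange[of l g "r @ w @ l'" h r'] stack_whisker[OF st', of "stgt s @ w" "[]"]
      by (intro heq_append_right) (auto simp: s a c)
    also have "heq (a @ w @ c) (stgt s @ w @ d)
       ([Slice (l @ gsrc g @ r @ w @ l') h r', Slice l g ((r @ w @ l') @ gtgt h @ r')] @ ?T)
       ([Slice (l @ gsrc g @ r @ w @ l') h r'] @ map (whisker (a @ w) []) ts @ [whisker [] (w @ d) s])"
      using heq_append_left[OF _ Cons.IH[OF st'], of "[Slice (l @ gsrc g @ r @ w @ l') h r']"]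
      by (simp add: s a c)
    finally show ?case by (simp add: s t a c)
  qed
  \<comment> \<open>First \<open>ss\<close> is raised above \<open>ts\<close> by the induction
    hypothesis, then \<open>s\<close> by \<open>one\<close>, so that \<open>s\<close> stays below
    \<open>ss\<close>.\<close>
  have "heq (a @ w @ c) (b @ w @ d)
    ([whisker [] (w @ c) s] @ map (whisker [] (w @ c)) ss @ map (whisker (b @ w) []) ts)
    ([whisker [] (w @ c) s] @ map (whisker (stgt s @ w) []) ts @ map (whisker [] (w @ d)) ss)"
    using Cons.IH[of "stgt s"] st by (intro heq_append_left) (auto simp: s a)
  also have "heq (a @ w @ c) (b @ w @ d)
    ([whisker [] (w @ c) s] @ map (whisker (stgt s @ w) []) ts @ map (whisker [] (w @ d)) ss)
    ((map (whisker (a @ w) []) ts @ [whisker [] (w @ d) s]) @ map (whisker [] (w @ d)) ss)"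
    using heq_append_right[OF one, of "map (whisker [] (w @ d)) ss" "b @ w @ d"]
      stack_whisker[OF st, of "[]" "w @ d"] by (simp add: s)
  finally show ?case by simp
qed

subsection \<open>Moving a dot across a strand\<close>

text \<open>A single dot, drawn as the right-hand curl of \<open>dot\<close>, on the upward strand
  between \<open>l\<close> and \<open>r\<close>.\<close>

definition dots :: "word \<Rightarrow> word \<Rightarrow> slice list" where
  "dots l r = [Slice (l @ [Up]) (Cup Up) r, Slice l (Cross Up Up) (Down # r),
     Slice (l @ [Up]) (Cap Up) r]"

lemma stack_dots: "stack (dots l r) (l @ Up # r) (l @ Up # r)"
  by (simp add: dots_def)

text \<open>The double-crossing term of relation (4). The second strand is pulled through the curl:
  sliding along cup and cap turns its crossings with the downward leg into crossings with the upward
  leg.\<close>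

lemma dots_slide_heq:
  "heq [Up, Up] [Up, Up]
    [Slice [Up] (Cup Up) [Up], Slice [Up, Up] (Cross Down Up) [], Slice [Up, Up] (Cross Up Down) [],
     Slice [] (Cross Up Up) [Down, Up], Slice [Up] (Cap Up) [Up]]
    ([Slice [] (Cross Up Up) []] @ dots [Up] [] @ [Slice [] (Cross Up Up) []])"
proof -
  let ?U = "[Up, Up]" and ?X = "Cross Up Up"
  have "heq ?U ?U
    [Slice [Up] (Cup Up) [Up], Slice [Up, Up] (Cross Down Up) [], Slice [Up, Up] (Cross Up Down) [],
     Slice [] ?X [Down, Up], Slice [Up] (Cap Up) [Up]]
    [Slice [Up, Up] (Cup Up) [], Slice [Up] ?X [Down], Slice [Up, Up] (Cross Up Down) [],
     Slice [] ?X [Down, Up], Slice [Up] (Cap Up) [Up]]"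
    using heq_append_right[OF heq_sym[OF heq_whisker[OF heq_slide_cup[of Up Up], of "[Up]" "[]"]],
        of "[Slice [Up, Up] (Cross Up Down) [], Slice [] ?X [Down, Up], Slice [Up] (Cap Up) [Up]]" ?U]
    by simp
  also have "heq ?U ?U \<dots>
    [Slice [Up, Up] (Cup Up) [], Slice [Up] ?X [Down], Slice [] ?X [Up, Down],
     Slice [Up, Up] (Cross Up Down) [], Slice [Up] (Cap Up) [Up]]"
    using heq_middle[OF heq_sym[OF heq_exchange[of "[]" ?X "[]" "Cross Up Down" "[]"]],
        of "[Slice [Up, Up] (Cup Up) [], Slice [Up] ?X [Down]]" ?U "[Slice [Up] (Cap Up) [Up]]" ?U]
    by simp
  also have "heq ?U ?U \<dots>
    [Slice [Up, Up] (Cup Up) [], Slice [Up] ?X [Down], Slice [] ?X [Up, Down],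
     Slice [Up] ?X [Down], Slice [Up, Up] (Cap Up) []]"
    using heq_append_left[OF _ heq_sym[OF heq_whisker[OF heq_slide_cap[of Up Up], of "[Up]" "[]"]],
        of "[Slice [Up, Up] (Cup Up) [], Slice [Up] ?X [Down], Slice [] ?X [Up, Down]]" ?U]
    by simp
  \<comment> \<open>Three crossings of upward strands remain. After the braid relation the outer two
    involve only the first two strands and can leave the curl below and above.\<close>
  also have "heq ?U ?U \<dots>
    [Slice [Up, Up] (Cup Up) [], Slice [] ?X [Up, Down], Slice [Up] ?X [Down],
     Slice [] ?X [Up, Down], Slice [Up, Up] (Cap Up) []]"
    using heq_middle[OF heq_sym[OF heq_whisker[OF heq_braid_up, of "[]" "[Down]"]],
        of "[Slice [Up, Up] (Cup Up) []]" ?U "[Slice [Up, Up] (Cap Up) []]" ?U]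
    by simp
  also have "heq ?U ?U \<dots>
    [Slice [] ?X [], Slice [Up, Up] (Cup Up) [], Slice [Up] ?X [Down],
     Slice [] ?X [Up, Down], Slice [Up, Up] (Cap Up) []]"
    using heq_append_right[OF heq_sym[OF heq_exchange[of "[]" ?X "[]" "Cup Up" "[]"]],
        of "[Slice [Up] ?X [Down], Slice [] ?X [Up, Down], Slice [Up, Up] (Cap Up) []]" ?U]
    by simp
  also have "heq ?U ?U \<dots>
    [Slice [] ?X [], Slice [Up, Up] (Cup Up) [], Slice [Up] ?X [Down],
     Slice [Up, Up] (Cap Up) [], Slice [] ?X []]"
    using heq_append_left[OF _ heq_exchange[of "[]" ?X "[]" "Cap Up" "[]"],
        of "[Slice [] ?X [], Slice [Up, Up] (Cup Up) [], Slice [Up] ?X [Down]]" ?U]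
    by simp
  finally show ?thesis by (simp add: dots_def)
qed

text \<open>The cap-cup term of relation (4): the arcs form two zigzags, and straightening them
  leaves the bare crossing.\<close>

lemma dots_reconnect_heq:
  "heq [Up, Up] [Up, Up]
    [Slice [Up] (Cup Up) [Up], Slice [Up, Up] (Cap Down) [], Slice [Up, Up] (Cup Down) [],
     Slice [] (Cross Up Up) [Down, Up], Slice [Up] (Cap Up) [Up]]
    [Slice [] (Cross Up Up) []]"
proof -
  let ?U = "[Up, Up]" and ?X = "Cross Up Up"
  have "heq ?U ?U
    [Slice [Up] (Cup Up) [Up], Slice [Up, Up] (Cap Down) [], Slice [Up, Up] (Cup Down) [],
     Slice [] ?X [Down, Up], Slice [Up] (Cap Up) [Up]]
    [Slice [Up, Up] (Cup Down) [], Slice [] ?X [Down, Up], Slice [Up] (Cap Up) [Up]]"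
    using heq_append_right[OF heq_whisker[OF heq_zigzag_right[of Up], of "[Up]" "[]"],
        of "[Slice [Up, Up] (Cup Down) [], Slice [] ?X [Down, Up], Slice [Up] (Cap Up) [Up]]" ?U]
    by simp
  also have "heq ?U ?U \<dots>
    [Slice [] ?X [], Slice [Up, Up] (Cup Down) [], Slice [Up] (Cap Up) [Up]]"
    using heq_append_right[OF heq_sym[OF heq_exchange[of "[]" ?X "[]" "Cup Down" "[]"]],
        of "[Slice [Up] (Cap Up) [Up]]" ?U]
    by simp
  also have "heq ?U ?U \<dots> [Slice [] ?X []]"
    using heq_append_left[OF _ heq_whisker[OF heq_zigzag_left[of Up], of "[Up]" "[]"],
        of "[Slice [] ?X []]" ?U]
    by simp
  finally show ?thesis .
qed

text \<open>The affine Hecke relation \<open>x\<^sub>i = s\<^sub>i x\<^sub>i\<^sub>+\<^sub>1 s\<^sub>i + s\<^sub>i\<close>: the downward leg of the curl is pulled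
  across the strand to its right.\<close>

lemma mor_dots:
  assumes xs: "stack xs u (l @ Up # Up # r)" and ys: "stack ys (l @ Up # Up # r) v"
  shows "mor u (xs @ dots l (Up # r) @ ys) v =
    mor u (xs @ [Slice l (Cross Up Up) r] @ dots (l @ [Up]) r @ [Slice l (Cross Up Up) r] @ ys) v +
    mor u (xs @ [Slice l (Cross Up Up) r] @ ys) v"
proof -
  let ?X = "Cross Up Up"
  let ?A = "[Slice (l @ [Up, Up]) (Cross Down Up) r, Slice (l @ [Up, Up]) (Cross Up Down) r]"
  let ?B = "[Slice (l @ [Up, Up]) (Cap Down) r, Slice (l @ [Up, Up]) (Cup Down) r]"
  let ?D = "[Slice l ?X (Down # Up # r), Slice (l @ [Up]) (Cap Up) (Up # r)]"
  have "mor u (xs @ dots l (Up # r) @ ys) v =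
    mor u (xs @ Slice (l @ [Up]) (Cup Up) (Up # r) # ?A @ ?D @ ys) v +
    mor u (xs @ Slice (l @ [Up]) (Cup Up) (Up # r) # ?B @ ?D @ ys) v"
    using mor_skein[of "xs @ [Slice (l @ [Up]) (Cup Up) (Up # r)]" u "l @ [Up, Up]" r
        "?D @ ys" v] xs ys
    by (simp add: dots_def stack_append)
  moreover have "heq u v (xs @ (Slice (l @ [Up]) (Cup Up) (Up # r) # ?A @ ?D) @ ys)
    (xs @ ([Slice l ?X r] @ dots (l @ [Up]) r @ [Slice l ?X r]) @ ys)"
    by (rule heq_middle[OF _ xs ys])
      (use heq_whisker[OF dots_slide_heq, of l r] in \<open>simp add: dots_def\<close>)
  moreover have "heq u v (xs @ (Slice (l @ [Up]) (Cup Up) (Up # r) # ?B @ ?D) @ ys)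
    (xs @ [Slice l ?X r] @ ys)"
    by (rule heq_middle[OF _ xs ys])
      (use heq_whisker[OF dots_reconnect_heq, of l r] in simp)
  ultimately show ?thesis by (simp add: heq_def)
qed

subsection \<open>The Coxeter presentation of the symmetric group\<close>

text \<open>The congruence of the Coxeter presentation. \<open>refl\<close> admits only letters in
  \<open>{1..<n}\<close>, so all related words give composable stacks of crossings.\<close>

inductive cox :: "nat \<Rightarrow> nat list \<Rightarrow> nat list \<Rightarrow> bool" for n where
  refl: "set v \<subseteq> {1..<n} \<Longrightarrow> cox n v v"
| sym: "cox n v w \<Longrightarrow> cox n w v"
| trans: "cox n u v \<Longrightarrow> cox n v w \<Longrightarrow> cox n u w"
| append: "cox n v v' \<Longrightarrow> cox n w w' \<Longrightarrow> cox n (v @ w) (v' @ w')"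
| square: "1 \<le> i \<Longrightarrow> i < n \<Longrightarrow> cox n [i, i] []"
| braid: "1 \<le> i \<Longrightarrow> Suc i < n \<Longrightarrow> cox n [Suc i, i, Suc i] [i, Suc i, i]"
| commute: "1 \<le> i \<Longrightarrow> Suc i < j \<Longrightarrow> j < n \<Longrightarrow> cox n [i, j] [j, i]"

declare cox.trans [trans]

lemma cox_mono: "cox m v w \<Longrightarrow> m \<le> n \<Longrightarrow> cox n v w"
proof (induction rule: cox.induct)
  case (refl v)
  then show ?case by (intro cox.refl) auto
qed (auto intro: cox.intros)

lemma cox_append_left: "set v \<subseteq> {1..<n} \<Longrightarrow> cox n w w' \<Longrightarrow> cox n (v @ w) (v @ w')"
  by (intro cox.append cox.refl)

lemma cox_append_right: "cox n v v' \<Longrightarrow> set w \<subseteq> {1..<n} \<Longrightarrow> cox n (v @ w) (v' @ w)"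
  by (intro cox.append cox.refl)

lemma cox_commute_list:
  assumes "i \<in> {1..<n}" "set w \<subseteq> {1..<n}" "\<And>j. j \<in> set w \<Longrightarrow> Suc i < j \<or> Suc j < i"
  shows "cox n (i # w) (w @ [i])"
  using assms(2,3)
proof (induction w)
  case Nil
  then show ?case using assms(1) by (auto intro: cox.refl)
next
  case (Cons j w)
  have "Suc i < j \<or> Suc j < i" using Cons.prems(2) by simp
  then have "cox n [i, j] [j, i]"
  proof
    assume "Suc i < j"
    then show ?thesis using assms(1) Cons.prems(1) by (intro cox.commute) auto
  next
    assume "Suc j < i"
    then show ?thesis using assms(1) Cons.prems(1) by (intro cox.sym[OF cox.commute]) auto
  qed
  from cox_append_right[OF this, of w] have "cox n (i # j # w) ([j] @ i # w)"
    using Cons.prems by simp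
  also have "cox n ([j] @ i # w) ([j] @ w @ [i])"
    using Cons by (intro cox_append_left) auto
  finally show ?case by simp
qed

text \<open>A permutation of \<open>{1..n+1}\<close> with \<open>n+1 \<mapsto> j\<close> is \<open>s\<^sub>j \<dots> s\<^sub>n\<close> times a permutation of \<open>{1..n}\<close>.\<close>

lemma cox_normal_form:
  assumes "set w \<subseteq> {1..<Suc n}"
  shows "\<exists>j u. 1 \<le> j \<and> j \<le> Suc n \<and> set u \<subseteq> {1..<n} \<and> cox (Suc n) w ([j..<Suc n] @ u)"
  using assms
proof (induction w)
  case Nil
  \<comment> \<open>The value \<open>Suc n\<close> for \<open>j\<close> stands for the empty
    run.\<close>
  show ?case by (rule exI[of _ "Suc n"], rule exI[of _ "[]"]) (auto intro: cox.refl)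
next
  case (Cons i w)
  then obtain j u where j: "1 \<le> j" "j \<le> Suc n" and u: "set u \<subseteq> {1..<n}"
    and c: "cox (Suc n) w ([j..<Suc n] @ u)" by auto
  have i: "1 \<le> i" "i \<le> n" using Cons.prems by auto
  have u': "set u \<subseteq> {1..<Suc n}" using u by auto
  have w: "cox (Suc n) (i # w) ([i] @ [j..<Suc n] @ u)"
    using cox_append_left[OF _ c, of "[i]"] i by simp
  \<comment> \<open>It is enough to bring \<open>i\<close> followed by the run into normal form; the
    remainder \<open>u'\<close> is absorbed into \<open>u\<close>.\<close>
  have step: ?case if "cox (Suc n) ([i] @ [j..<Suc n]) ([j'..<Suc n] @ u')"
    "set u' \<subseteq> {1..<n}" "1 \<le> j'" "j' \<le> Suc n" for j' u'
  proof (intro exI conjI)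
    show "cox (Suc n) (i # w) ([j'..<Suc n] @ u' @ u)"
      using cox.trans[OF w] cox_append_right[OF that(1) u'] by simp
  qed (use that u in auto)
  consider "Suc i < j" | "j = Suc i" | "i = j" | "j < i" by linarith
  then show ?case
  proof cases
    case 1
    have "cox (Suc n) (i # [j..<Suc n]) ([j..<Suc n] @ [i])"
      using 1 i j by (intro cox_commute_list) auto
    then show ?thesis using 1 i j by (intro step[of j "[i]"]) auto
  next
    case 2
    then have "[i] @ [j..<Suc n] = [i..<Suc n]" using i by (simp add: upt_conv_Cons del: upt_Suc)
    then have "cox (Suc n) ([i] @ [j..<Suc n]) ([i..<Suc n] @ [])"
      using i by (simp del: upt_Suc) (auto intro!: cox.refl)
    then show ?thesis using i by (intro step[of i "[]"]) auto
  next
    case 3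
    have e: "[i] @ [j..<Suc n] = [i, i] @ [Suc i..<Suc n]"
      using 3 i by (simp add: upt_conv_Cons del: upt_Suc)
    have "cox (Suc n) ([i, i] @ [Suc i..<Suc n]) ([] @ [Suc i..<Suc n])"
      using i by (intro cox_append_right cox.square) auto
    then show ?thesis using i e by (intro step[of "Suc i" "[]"]) (auto simp del: upt_Suc)
  next
    \<comment> \<open>The letter \<open>i\<close> passes through the run and comes out as
      \<open>p\<close>, its predecessor: it commutes with the letters below \<open>p\<close>, the
      braid relation acts on \<open>i, p, i\<close>, and \<open>p\<close> commutes with the letters
      above \<open>i\<close>.\<close>
    case 4
    then obtain p where p: "i = Suc p" "j \<le> p" by (cases i) auto
    let ?A = "[j..<p]" and ?B = "[Suc i..<Suc n]"
    have e: "[j..<Suc n] = ?A @ [p, i] @ ?B"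
      using p i upt_add_eq_append[of j p "Suc n - p"]
      by (simp add: upt_conv_Cons del: upt_Suc)
    have "cox (Suc n) ((i # ?A) @ [p, i] @ ?B) ((?A @ [i]) @ [p, i] @ ?B)"
      using p i j by (intro cox_append_right cox_commute_list) auto
    also have "cox (Suc n) ((?A @ [i]) @ [p, i] @ ?B) (?A @ [p, i, p] @ ?B)"
      using p i j cox_append_left[OF _ cox_append_right[OF cox.braid[of p "Suc n"], of ?B], of ?A]
      by (auto simp del: upt_Suc)
    also have "cox (Suc n) (?A @ [p, i, p] @ ?B) ((?A @ [p, i]) @ ?B @ [p])"
      using p i j cox_append_left[OF _ cox_commute_list[of p "Suc n" ?B], of "?A @ [p, i]"]
      by (auto simp del: upt_Suc)
    finally show ?thesis using p i j by (intro step[of j "[p]"]) (auto simp: e simp del: upt_Suc)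
  qed
qed

section \<open>Words as permutations\<close>

lemma word_perm_Nil [simp]: "word_perm [] = id"
  by (simp add: word_perm_def)

lemma word_perm_Cons [simp]: "word_perm (i # w) = transpose i (Suc i) \<circ> word_perm w"
  by (simp add: word_perm_def)

lemma word_perm_append [simp]: "word_perm (v @ w) = word_perm v \<circ> word_perm w"
  by (induction v) (simp_all add: comp_assoc)

lemma bij_word_perm: "bij (word_perm w)"
  by (induction w) (simp_all only: word_perm_Nil word_perm_Cons bij_id bij_comp bij_transpose)

lemma word_perm_cox: "cox n v w \<Longrightarrow> word_perm v = word_perm w"
proof (induction rule: cox.induct)
  case (braid i)
  show ?case by (rule ext) (simp add: transpose_def)
next
  case (commute i j)
  then show ?case by (intro ext) (simp add: transpose_def)
qed simp_all

lemma word_perm_permutes: "set w \<subseteq> {a..<n} \<Longrightarrow> word_perm w permutes {a..n}"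
  by (induction w) (auto simp: permutes_id intro!: permutes_compose permutes_swap_id)

text \<open>Reads the start of the run in the normal form off the image of the last point.\<close>

lemma word_perm_upt: "j \<le> m \<Longrightarrow> word_perm [j..<m] m = j"
proof (induction "m - j" arbitrary: j)
  case (Suc d)
  then have "[j..<m] = j # [Suc j..<m]" by (simp add: upt_conv_Cons)
  then show ?case using Suc.hyps(1)[of "Suc j"] Suc.hyps(2) by simp
qed simp

text \<open>Completeness of the Coxeter relations. Both words are put in normal form; equal images
  of the last point give equal runs, and cancelling these leaves words on fewer letters.\<close>

lemma cox_of_word_perm_eq:
  assumes "set v \<subseteq> {1..<n}" "set w \<subseteq> {1..<n}" "word_perm v = word_perm w"
  shows "cox n v w"
  using assms
proof (induction n arbitrary: v w)
  case 0
  then show ?case by (auto intro: cox.refl)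
next
  case (Suc n)
  obtain j u where j: "1 \<le> j" "j \<le> Suc n" and u: "set u \<subseteq> {1..<n}"
    and c: "cox (Suc n) v ([j..<Suc n] @ u)" using cox_normal_form[OF Suc.prems(1)] by blast
  obtain j' u' where j': "1 \<le> j'" "j' \<le> Suc n" and u': "set u' \<subseteq> {1..<n}"
    and c': "cox (Suc n) w ([j'..<Suc n] @ u')" using cox_normal_form[OF Suc.prems(2)] by blast
  have eq: "word_perm [j..<Suc n] \<circ> word_perm u = word_perm [j'..<Suc n] \<circ> word_perm u'"
    using Suc.prems(3) word_perm_cox[OF c] word_perm_cox[OF c'] by (metis word_perm_append)
  \<comment> \<open>The remainders fix the last point, so its image is determined by the run
    alone.\<close>
  have fix_last: "word_perm x (Suc n) = Suc n" if "set x \<subseteq> {1..<n}" for x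
    using permutes_not_in[OF word_perm_permutes[OF that]] by simp
  have "j = j'"
    using fun_cong[OF eq, of "Suc n"] word_perm_upt[OF j(2)] word_perm_upt[OF j'(2)]
      fix_last[OF u] fix_last[OF u'] by (simp del: upt_Suc)
  moreover have "word_perm u = word_perm u'"
    using eq \<open>j = j'\<close> bij_is_inj[OF bij_word_perm, of "[j..<Suc n]"]
    by (auto simp: fun_eq_iff inj_eq simp del: upt_Suc)
  then have "cox n u u'" using Suc.IH[OF u u'] by simp
  then have "cox (Suc n) u u'" by (rule cox_mono) simp
  then have "cox (Suc n) ([j..<Suc n] @ u) ([j..<Suc n] @ u')"
    using j by (intro cox_append_left) auto
  ultimately show ?case using c c' by (metis cox.trans cox.sym)
qed

subsection \<open>Closures of words in the crossings\<close>

lemma ups_simps: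
  "ups 0 = []" "ups (Suc n) = Up # ups n" "ups n @ Up # r = Up # ups n @ r"
  "ups m @ ups n = ups (m + n)" "ups m @ ups n @ r = ups (m + n) @ r"
  by (simp_all add: ups_def replicate_app_Cons_same replicate_add)

lemma downs_simps:
  "downs 0 = []" "downs (Suc n) = Down # downs n" "downs n @ Down # r = Down # downs n @ r"
  "downs m @ downs n = downs (m + n)" "downs m @ downs n @ r = downs (m + n) @ r"
  by (simp_all add: downs_def replicate_app_Cons_same replicate_add)

lemmas word_simps = ups_simps downs_simps

definition crs :: "nat \<Rightarrow> word \<Rightarrow> nat \<Rightarrow> slice" where
  "crs n r i = Slice (ups (i - 1)) (Cross Up Up) (ups (n - i - 1) @ r)"

lemma crs_Suc: "crs (Suc (Suc (a + b))) r (Suc a) = Slice (ups a) (Cross Up Up) (ups b @ r)"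
  by (simp add: crs_def)

text \<open>Counts the strands on either side by sums, avoiding the truncated subtractions of
  \<open>crs\<close>.\<close>

lemma crs_cases:
  assumes "i \<in> {1..<n}"
  obtains a b where "i = Suc a" "n = Suc (Suc (a + b))"
proof -
  from assms have "i = Suc (i - 1)" "n = Suc (Suc ((i - 1) + (n - i - 1)))" by auto
  then show ?thesis using that by blast
qed

lemma crs_boundary:
  assumes "i \<in> {1..<n}"
  shows "ssrc (crs n r i) = ups n @ r" "stgt (crs n r i) = ups n @ r"
proof -
  obtain a b where "i = Suc a" "n = Suc (Suc (a + b))" using assms by (rule crs_cases)
  then show "ssrc (crs n r i) = ups n @ r" "stgt (crs n r i) = ups n @ r"
    by (simp_all add: crs_Suc word_simps)
qed

lemma whisker_crs: "whisker [] r' (crs n r i) = crs n (r @ r') i"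
  by (simp add: crs_def)

lemma stack_crs: "set w \<subseteq> {1..<n} \<Longrightarrow> stack (map (crs n r) w) (ups n @ r) (ups n @ r)"
  by (induction w) (auto simp: crs_boundary)

text \<open>Each Coxeter relation is a local relation or an exchange of heights. Words are reversed
  because their last letter is the lowest crossing.\<close>

lemma heq_cox:
  assumes "cox n v w"
  shows "heq (ups n @ r) (ups n @ r) (map (crs n r) (rev v)) (map (crs n r) (rev w))"
  using assms
proof (induction rule: cox.induct)
  case (refl v)
  then show ?case by (intro heq_refl stack_crs) auto
next
  case (sym v w)
  show ?case by (rule heq_sym[OF sym.IH])
next
  case (trans u v w)
  show ?case by (rule heq_trans[OF trans.IH])
next
  case (append v v' w w')
  then show ?case by (simp add: heq_append)
next
  case (square i)
  then obtain a b where ab: "i = Suc a" "n = Suc (Suc (a + b))" using crs_cases[of i n] by auto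
  show ?case using heq_whisker[OF heq_double_up, of "ups a" "ups b @ r"]
    by (simp add: ab crs_Suc word_simps)
next
  case (braid i)
  then obtain a b where ab: "Suc i = Suc a" "n = Suc (Suc (a + b))"
    using crs_cases[of "Suc i" n] by auto
  with braid obtain c where c: "a = Suc c" "i = Suc c" by (cases a) auto
  show ?case
    using heq_sym[OF heq_whisker[OF heq_braid_up, of "ups c" "ups b @ r"]] ab c
      crs_Suc[of c "Suc b" r] crs_Suc[of "Suc c" b r]
    by (simp add: word_simps)
next
  case (commute i j)
  then obtain a b where ab: "j = Suc a" "n = Suc (Suc (a + b))" using crs_cases[of j n] by auto
  \<comment> \<open>There are \<open>c\<close> strands to the left of both crossings and
    \<open>d\<close> strands between them.\<close>
  define c where "c = i - 1"
  define d where "d = a - i - 1"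
  have cd: "i = Suc c" "a = c + d + 2" using commute ab by (auto simp: c_def d_def)
  show ?case
    using heq_sym[OF heq_exchange[of "ups c" "Cross Up Up" "ups d" "Cross Up Up" "ups b @ r"]]
      crs_Suc[of a b r] crs_Suc[of c "d + 2 + b" r]
    by (simp add: ab cd word_simps algebra_simps)
qed

section \<open>Nested arcs\<close>

definition cups :: "nat \<Rightarrow> slice list" where
  "cups m = map (\<lambda>j. Slice (ups j) (Cup Up) (downs j)) [0..<m]"

definition caps :: "nat \<Rightarrow> slice list" where
  "caps m = map (\<lambda>j. Slice (ups j) (Cap Up) (downs j)) (rev [0..<m])"

text \<open>Separates the outer \<open>a\<close> arcs from the \<open>b\<close> arcs inside them.
  Either the outermost or the innermost arc can thus be split off.\<close>

lemma cups_add: "cups (a + b) = cups a @ map (whisker (ups a) (downs a)) (cups b)"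
  by (induction b) (simp_all add: cups_def word_simps add.commute)

lemma caps_add: "caps (a + b) = map (whisker (ups a) (downs a)) (caps b) @ caps a"
  by (induction b) (simp_all add: caps_def word_simps add.commute)

lemma cups_Suc: "cups (Suc m) = Slice [] (Cup Up) [] # map (whisker [Up] [Down]) (cups m)"
  using cups_add[of 1 m] by (simp add: cups_def word_simps)

lemma caps_Suc: "caps (Suc m) = map (whisker [Up] [Down]) (caps m) @ [Slice [] (Cap Up) []]"
  using caps_add[of 1 m] by (simp add: caps_def word_simps)

lemma stack_cups: "stack (cups m) [] (ups m @ downs m)"
proof (induction m)
  case (Suc m)
  then show ?case using stack_whisker[OF Suc, of "[Up]" "[Down]"]
    by (simp add: cups_Suc word_simps)
qed (simp add: cups_def word_simps)

lemma stack_caps: "stack (caps m) (ups m @ downs m) []"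
proof (induction m)
  case (Suc m)
  then show ?case using stack_append[OF stack_whisker[OF Suc, of "[Up]" "[Down]"]]
    by (simp add: caps_Suc word_simps)
qed (simp add: caps_def word_simps)

lemma nested_cups_mor: "nested_cups m = mor [] (cups m) (ups m @ downs m)"
proof (induction m)
  case (Suc m)
  then show ?case
    using stack_whisker[OF stack_cups, of "[Up]" "[Down]" m]
    by (simp add: hgen_mor mor_whisker[symmetric] stack_cups mor_comp cups_Suc word_simps)
qed (simp add: cups_def word_simps hid_mor)

lemma nested_caps_mor: "nested_caps m = mor (ups m @ downs m) (caps m) []"
proof (induction m)
  case (Suc m)
  then show ?case
    using stack_whisker[OF stack_caps, of "[Up]" "[Down]" m]
    by (simp add: hgen_mor mor_whisker[symmetric] stack_caps mor_comp caps_Suc word_simps)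
qed (simp add: caps_def word_simps hid_mor)

lemma word_crossings_mor:
  "set w \<subseteq> {1..<n} \<Longrightarrow> word_crossings n w = mor (ups n) (map (crs n []) (rev w)) (ups n)"
proof (induction w)
  case Nil
  then show ?case by (simp add: word_crossings_def hid_mor)
next
  case (Cons i w)
  have "crossing_at n i = mor (ups n) [crs n [] i] (ups n)"
    using mor_whisker[of "[Slice [] (Cross Up Up) []]" "[Up, Up]" "[Up, Up]"
        "ups (i - 1)" "ups (n - i - 1)"] crs_boundary[of i n "[]"] Cons.prems
    by (simp add: crossing_at_def hgen_mor crs_def)
  moreover have "word_crossings n (i # w) = crossing_at n i \<circ>\<^sub>H word_crossings n w"
    by (simp add: word_crossings_def)
  ultimately show ?case
    using Cons stack_crs[of "rev w" n "[]"] crs_boundary[of i n "[]"] by (simp add: mor_comp)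
qed

section \<open>Closures leaving the first strand open\<close>

definition lcups :: "nat \<Rightarrow> slice list" where
  "lcups m = map (whisker [Up] []) (cups m)"

definition lcaps :: "nat \<Rightarrow> slice list" where
  "lcaps m = map (whisker [Up] []) (caps m)"

lemma stack_lcups: "stack (lcups m) [Up] (ups (Suc m) @ downs m)"
  using stack_whisker[OF stack_cups, of "[Up]" "[]"] by (simp add: lcups_def word_simps)

lemma stack_lcaps: "stack (lcaps m) (ups (Suc m) @ downs m) [Up]"
  using stack_whisker[OF stack_caps, of "[Up]" "[]"] by (simp add: lcaps_def word_simps)

text \<open>The index \<open>m\<close> is the number of closed strands: the words are in \<open>S\<^sub>m\<^sub>+\<^sub>1\<close>, and they are reversed
  because slices are listed from bottom to top.\<close>

definition closure_mor :: "nat \<Rightarrow> nat list \<Rightarrow> heis" where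
  "closure_mor m w = mor [Up] (lcups m @ map (crs (Suc m) (downs m)) (rev w) @ lcaps m) [Up]"

lemma partial_closure_word_crossings:
  assumes "set w \<subseteq> {1..<Suc m}"
  shows "partial_closure (Suc m) (word_crossings (Suc m) w) = closure_mor m w"
proof -
  have "hid [Up] \<otimes>\<^sub>H nested_cups m = mor [Up] (lcups m) (ups (Suc m) @ downs m)"
    by (simp add: nested_cups_mor hid_mor mor_tensor stack_cups lcups_def word_simps)
  moreover have "hid [Up] \<otimes>\<^sub>H nested_caps m = mor (ups (Suc m) @ downs m) (lcaps m) [Up]"
    by (simp add: nested_caps_mor hid_mor mor_tensor stack_caps lcaps_def word_simps)
  moreover have "word_crossings (Suc m) w \<otimes>\<^sub>H hid (downs m) =
    mor (ups (Suc m) @ downs m) (map (crs (Suc m) (downs m)) (rev w)) (ups (Suc m) @ downs m)"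
    using assms stack_crs[of "rev w" "Suc m" "[]"]
    by (simp add: word_crossings_mor hid_mor mor_tensor whisker_crs rev_map o_def)
  moreover have "stack (map (crs (Suc m) (downs m)) (rev w)) (ups (Suc m) @ downs m) (ups (Suc m) @ downs m)"
    using assms by (intro stack_crs) simp
  ultimately show ?thesis
    using stack_lcups[of m] stack_lcaps[of m]
    by (simp add: partial_closure_def closure_mor_def mor_comp stack_append)
qed

text \<open>By completeness of the Coxeter relations a closure depends only on the
  permutation.\<close>

lemma closure_mor_cong:
  assumes "set v \<subseteq> {1..<Suc m}" "set w \<subseteq> {1..<Suc m}" "word_perm v = word_perm w"
  shows "closure_mor m v = closure_mor m w"
  using heq_middle[OF heq_cox[OF cox_of_word_perm_eq[OF assms]] stack_lcups stack_lcaps]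
  by (simp add: closure_mor_def heq_def)

text \<open>Two cup slides move the crossing from the left legs of two nested arcs to their right
  legs; in between, the cups trade heights.\<close>

lemma cups2_slide:
  "heq [] [Up, Up, Down, Down]
    [Slice [] (Cup Up) [], Slice [Up] (Cup Up) [Down], Slice [] (Cross Up Up) [Down, Down]]
    [Slice [] (Cup Up) [], Slice [Up] (Cup Up) [Down], Slice [Up, Up] (Cross Down Down) []]"
proof -
  let ?V = "[Up, Up, Down, Down]"
  have "heq [] ?V
    [Slice [] (Cup Up) [], Slice [Up] (Cup Up) [Down], Slice [] (Cross Up Up) [Down, Down]]
    [Slice [] (Cup Up) [], Slice [] (Cup Up) [Up, Down], Slice [Up] (Cross Down Up) [Down]]"
    using heq_append_left[OF _ heq_whisker[OF heq_slide_cup[of Up Up], of "[]" "[Down]"],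
        of "[Slice [] (Cup Up) []]" "[]"] by simp
  also have "heq [] ?V \<dots>
    [Slice [] (Cup Up) [], Slice [Up, Down] (Cup Up) [], Slice [Up] (Cross Down Up) [Down]]"
    using heq_append_right[OF heq_sym[OF heq_exchange[of "[]" "Cup Up" "[]" "Cup Up" "[]"]],
        of "[Slice [Up] (Cross Down Up) [Down]]" ?V] by simp
  also have "heq [] ?V \<dots>
    [Slice [] (Cup Up) [], Slice [Up] (Cup Up) [Down], Slice [Up, Up] (Cross Down Down) []]"
    using heq_append_left[OF _ heq_whisker[OF heq_slide_cup[of Down Up], of "[Up]" "[]"],
        of "[Slice [] (Cup Up) []]" "[]"] by simp
  finally show ?thesis .
qed

lemma caps2_slide:
  "heq [Up, Up, Down, Down] []
    [Slice [] (Cross Up Up) [Down, Down], Slice [Up] (Cap Up) [Down], Slice [] (Cap Up) []]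
    [Slice [Up, Up] (Cross Down Down) [], Slice [Up] (Cap Up) [Down], Slice [] (Cap Up) []]"
proof -
  let ?V = "[Up, Up, Down, Down]"
  have "heq ?V []
    [Slice [] (Cross Up Up) [Down, Down], Slice [Up] (Cap Up) [Down], Slice [] (Cap Up) []]
    [Slice [Up] (Cross Up Down) [Down], Slice [] (Cap Up) [Up, Down], Slice [] (Cap Up) []]"
    using heq_append_right[OF heq_whisker[OF heq_slide_cap[of Up Up], of "[]" "[Down]"],
        of "[Slice [] (Cap Up) []]" "[]"] by simp
  also have "heq ?V [] \<dots>
    [Slice [Up] (Cross Up Down) [Down], Slice [Up, Down] (Cap Up) [], Slice [] (Cap Up) []]"
    using heq_append_left[OF _ heq_exchange[of "[]" "Cap Up" "[]" "Cap Up" "[]"],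
        of "[Slice [Up] (Cross Up Down) [Down]]" ?V] by simp
  also have "heq ?V [] \<dots>
    [Slice [Up, Up] (Cross Down Down) [], Slice [Up] (Cap Up) [Down], Slice [] (Cap Up) []]"
    using heq_append_right[OF heq_whisker[OF heq_slide_cap[of Up Down], of "[Up]" "[]"],
        of "[Slice [] (Cap Up) []]" "[]"] by simp
  finally show ?thesis .
qed

text \<open>The crossing meets two neighbouring arcs; the \<open>b\<close> arcs inside them are
  drawn later and exchange with it. The right legs appear in reverse order, so \<open>a\<close> and
  \<open>b\<close> trade sides.\<close>

lemma cups_slide:
  fixes a b :: nat
  defines "m \<equiv> Suc (Suc (a + b))"
  shows "heq [] (ups m @ downs m)
    (cups m @ [crs m (downs m) (Suc a)])
    (cups m @ [Slice (ups m @ downs b) (Cross Down Down) (downs a)])"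
proof -
  let ?W = "ups m @ downs m"
  let ?I = "map (whisker (ups (Suc (Suc a))) (downs (Suc (Suc a)))) (cups b)"
  let ?U = "ups (Suc (Suc a))" and ?D = "downs (Suc (Suc a))"
  have c2: "cups (Suc (Suc 0)) = [Slice [] (Cup Up) [], Slice [Up] (Cup Up) [Down]]"
    by (simp add: cups_def word_simps)
  have split: "cups m = cups (Suc (Suc a)) @ ?I"
    using cups_add[of "Suc (Suc a)" b] by (simp add: m_def)
  have split2: "cups (Suc (Suc a)) = cups a @ map (whisker (ups a) (downs a))
      [Slice [] (Cup Up) [], Slice [Up] (Cup Up) [Down]]"
    using cups_add[of a "Suc (Suc 0)"] unfolding c2 by simp
  have I: "stack ?I (?U @ ?D) ?W"
    using stack_whisker[OF stack_cups[of b], of ?U ?D] by (simp add: m_def word_simps add.commute)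
  have x1: "heq (?U @ ?D) ?W (Slice (ups a) (Cross Up Up) ?D # ?I) (?I @ [crs m (downs m) (Suc a)])"
    using heq_whisker[OF heq_exchange_slices[of "[Slice [] (Cross Up Up) []]" "[Up, Up]" "[Up, Up]"
          "cups b" "[]" "ups b @ downs b" "[]"], of "ups a" ?D] stack_cups[of b]
    by (simp add: m_def crs_Suc word_simps add.commute o_def whisker_whisker)
  have x2: "heq (?U @ ?D) ?W (?I @ [Slice (ups m @ downs b) (Cross Down Down) (downs a)])
      (Slice ?U (Cross Down Down) (downs a) # ?I)"
    using heq_whisker[OF heq_exchange_slices[of "cups b" "[]" "ups b @ downs b"
          "[Slice [] (Cross Down Down) []]" "[Down, Down]" "[Down, Down]" "[]"], of ?U "downs a"]
      stack_cups[of b]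
    by (simp add: m_def word_simps add.commute o_def whisker_whisker)
  have x3: "heq [] (?U @ ?D) (cups (Suc (Suc a)) @ [Slice (ups a) (Cross Up Up) ?D])
      (cups (Suc (Suc a)) @ [Slice ?U (Cross Down Down) (downs a)])"
    using heq_append_left[OF _ heq_whisker[OF cups2_slide, of "ups a" "downs a"], of "cups a" "[]"]
      stack_cups[of a] by (simp add: split2 word_simps)
  have "heq [] ?W (cups m @ [crs m (downs m) (Suc a)])
      (cups (Suc (Suc a)) @ Slice (ups a) (Cross Up Up) ?D # ?I)"
    using heq_append_left[OF stack_cups heq_sym[OF x1]] by (simp add: split)
  also have "heq [] ?W \<dots> (cups (Suc (Suc a)) @ Slice ?U (Cross Down Down) (downs a) # ?I)"
    using heq_append_right[OF x3 I] by simp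
  also have "heq [] ?W \<dots> (cups m @ [Slice (ups m @ downs b) (Cross Down Down) (downs a)])"
    using heq_append_left[OF stack_cups heq_sym[OF x2]] by (simp add: split)
  finally show ?thesis .
qed

text \<open>The counterpart at the top; it produces the same downward crossing as
  \<open>cups_slide\<close>, so the two can be joined.\<close>

lemma caps_slide:
  fixes a b :: nat
  defines "m \<equiv> Suc (Suc (a + b))"
  shows "heq (ups m @ downs m) []
    (crs m (downs m) (Suc a) # caps m)
    (Slice (ups m @ downs b) (Cross Down Down) (downs a) # caps m)"
proof -
  let ?W = "ups m @ downs m"
  let ?I = "map (whisker (ups (Suc (Suc a))) (downs (Suc (Suc a)))) (caps b)"
  let ?U = "ups (Suc (Suc a))" and ?D = "downs (Suc (Suc a))"
  have c2: "caps (Suc (Suc 0)) = [Slice [Up] (Cap Up) [Down], Slice [] (Cap Up) []]"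
    by (simp add: caps_def word_simps)
  have split: "caps m = ?I @ caps (Suc (Suc a))"
    using caps_add[of "Suc (Suc a)" b] by (simp add: m_def)
  have split2: "caps (Suc (Suc a)) = map (whisker (ups a) (downs a))
      [Slice [Up] (Cap Up) [Down], Slice [] (Cap Up) []] @ caps a"
    using caps_add[of a "Suc (Suc 0)"] unfolding c2 by simp
  have I: "stack ?I ?W (?U @ ?D)"
    using stack_whisker[OF stack_caps[of b], of ?U ?D] by (simp add: m_def word_simps add.commute)
  have x1: "heq ?W (?U @ ?D) (crs m (downs m) (Suc a) # ?I) (?I @ [Slice (ups a) (Cross Up Up) ?D])"
    using heq_whisker[OF heq_exchange_slices[of "[Slice [] (Cross Up Up) []]" "[Up, Up]" "[Up, Up]"
          "caps b" "ups b @ downs b" "[]" "[]"], of "ups a" ?D] stack_caps[of b]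
    by (simp add: m_def crs_Suc word_simps add.commute o_def whisker_whisker)
  have x2: "heq ?W (?U @ ?D) (?I @ [Slice ?U (Cross Down Down) (downs a)])
      (Slice (ups m @ downs b) (Cross Down Down) (downs a) # ?I)"
    using heq_whisker[OF heq_exchange_slices[of "caps b" "ups b @ downs b" "[]"
          "[Slice [] (Cross Down Down) []]" "[Down, Down]" "[Down, Down]" "[]"], of ?U "downs a"]
      stack_caps[of b]
    by (simp add: m_def word_simps add.commute o_def whisker_whisker)
  have x3: "heq (?U @ ?D) [] (Slice (ups a) (Cross Up Up) ?D # caps (Suc (Suc a)))
      (Slice ?U (Cross Down Down) (downs a) # caps (Suc (Suc a)))"
    using heq_append_right[OF heq_whisker[OF caps2_slide, of "ups a" "downs a"], of "caps a" "[]"]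
      stack_caps[of a] by (simp add: split2 word_simps)
  have "heq ?W [] (crs m (downs m) (Suc a) # caps m)
      (?I @ Slice (ups a) (Cross Up Up) ?D # caps (Suc (Suc a)))"
    using heq_append_right[OF x1 stack_caps] by (simp add: split)
  also have "heq ?W [] \<dots> (?I @ Slice ?U (Cross Down Down) (downs a) # caps (Suc (Suc a)))"
    using heq_append_left[OF I x3] by simp
  also have "heq ?W [] \<dots> (Slice (ups m @ downs b) (Cross Down Down) (downs a) # caps m)"
    using heq_append_right[OF x2 stack_caps] by (simp add: split)
  finally show ?thesis .
qed

text \<open>The trace property: the crossing travels around the closing arcs from bottom to top. The
  bound \<open>2\<close> keeps it away from the open strand.\<close>

lemma closure_mor_rotate1:
  assumes "i \<in> {2..<Suc m}" "set w \<subseteq> {1..<Suc m}"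
  shows "closure_mor m (i # w) = closure_mor m (w @ [i])"
proof -
  \<comment> \<open>Numbered among the closed strands alone, the crossing has position
    \<open>i - 1\<close>.\<close>
  from assms(1) have "i - 1 \<in> {1..<m}" by auto
  then obtain a b where "i - 1 = Suc a" and m: "m = Suc (Suc (a + b))" by (rule crs_cases)
  then have i: "i = Suc (Suc a)" by simp
  let ?W = "ups (Suc m) @ downs m"
  let ?Y = "Slice (ups (Suc m) @ downs b) (Cross Down Down) (downs a)"
  let ?B = "map (crs (Suc m) (downs m)) (rev w)"
  have w: "stack ?B ?W ?W" using assms(2) by (intro stack_crs) simp
  have c: "whisker [Up] [] (crs m (downs m) (Suc a)) = crs (Suc m) (downs m) i"
    by (simp add: i crs_def word_simps)
  have lc: "heq [Up] ?W (lcups m @ [crs (Suc m) (downs m) i]) (lcups m @ [?Y])"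
    using heq_whisker[OF cups_slide[of a b], of "[Up]" "[]"] c
    by (simp add: lcups_def m[symmetric] word_simps)
  have lp: "heq ?W [Up] (crs (Suc m) (downs m) i # lcaps m) (?Y # lcaps m)"
    using heq_whisker[OF caps_slide[of a b], of "[Up]" "[]"] c
    by (simp add: lcaps_def m[symmetric] word_simps)
  \<comment> \<open>On the downward strands the crossing lies to the right of all of
    \<open>w\<close> and moves past it.\<close>
  have ex: "heq ?W ?W (?B @ [?Y]) (?Y # ?B)"
    using heq_exchange_slices[of "map (crs (Suc m) []) (rev w)" "ups (Suc m)" "ups (Suc m)"
        "[Slice (downs b) (Cross Down Down) (downs a)]" "downs m" "downs m" "[]"]
      stack_crs[of "rev w" "Suc m" "[]"] assms(2)
    by (simp add: m word_simps whisker_crs o_def add.commute)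
  have "heq [Up] [Up] (lcups m @ map (crs (Suc m) (downs m)) (rev (w @ [i])) @ lcaps m)
     (lcups m @ [?Y] @ ?B @ lcaps m)"
    using heq_append_right[OF lc stack_append[OF w stack_lcaps]] by simp
  also have "heq [Up] [Up] \<dots> (lcups m @ (?B @ [?Y]) @ lcaps m)"
    using heq_middle[OF heq_sym[OF ex] stack_lcups stack_lcaps] by simp
  also have "heq [Up] [Up] \<dots> (lcups m @ map (crs (Suc m) (downs m)) (rev (i # w)) @ lcaps m)"
    using heq_append_left[OF stack_append[OF stack_lcups w] heq_sym[OF lp]] by simp
  finally show ?thesis by (simp add: closure_mor_def heq_def)
qed

text \<open>Rotation brings the two copies of a letter together, where they cancel.\<close>

lemma closure_mor_conjugate:
  assumes "set v \<subseteq> {2..<Suc m}" "set w \<subseteq> {1..<Suc m}"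
  shows "closure_mor m (v @ w @ rev v) = closure_mor m w"
  using assms(1)
proof (induction v)
  case (Cons i v)
  let ?x = "v @ w @ rev v"
  have x: "set ?x \<subseteq> {1..<Suc m}" and i: "i \<in> {2..<Suc m}" using Cons.prems assms(2) by auto
  have "closure_mor m (i # ?x @ [i]) = closure_mor m ((?x @ [i]) @ [i])"
    using x i by (intro closure_mor_rotate1) auto
  also have "\<dots> = closure_mor m ?x"
    using x i by (intro closure_mor_cong) (auto simp: comp_assoc)
  finally show ?case using Cons by simp
qed simp

subsection \<open>Multiplication by the dot\<close>

lemma dot_mor: "dot = mor [Up] (dots [] []) [Up]"
  by (simp add: dot_def hid_mor hgen_mor mor_tensor mor_comp dots_def)

text \<open>A palindromic word for the transposition \<open>(a j+1)\<close>.\<close>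

definition star :: "nat \<Rightarrow> nat \<Rightarrow> nat list" where
  "star a j = [a..<Suc j] @ rev [a..<j]"

lemma set_star: "a \<le> j \<Longrightarrow> j < n \<Longrightarrow> set (star a j) \<subseteq> {a..<n}"
  by (auto simp: star_def)

lemma rev_star: "a \<le> j \<Longrightarrow> rev (star a j) = star a j"
  by (simp add: star_def)

text \<open>Iterates \<open>mor_dots\<close>: each step moves the dot one strand to the right,
  between a run and its reverse, and leaves behind the word of one transposition.\<close>

lemma mor_dots_expand:
  assumes A: "stack A u (ups (Suc m) @ r)" and B: "stack B (ups (Suc m) @ r) v" and "j \<le> m"
  shows "mor u (A @ dots [] (ups m @ r) @ B) v =
    (\<Sum>i = 1..j. mor u (A @ map (crs (Suc m) r) (star 1 i) @ B) v) +
    mor u (A @ map (crs (Suc m) r) [1..<Suc j] @ dots (ups j) (ups (m - j) @ r) @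
      map (crs (Suc m) r) (rev [1..<Suc j]) @ B) v"
  using assms(3)
proof (induction j)
  case 0
  then show ?case by (simp add: word_simps)
next
  case (Suc j)
  let ?c = "crs (Suc m) r"
  let ?A = "A @ map ?c [1..<Suc j]" and ?B = "map ?c (rev [1..<Suc j]) @ B"
  have c: "?c (Suc j) = Slice (ups j) (Cross Up Up) (ups (m - Suc j) @ r)"
    by (simp add: crs_def)
  have mj: "m - j = Suc (m - Suc j)" using Suc.prems by simp
  have e: "ups (Suc m) @ r = ups j @ Up # Up # ups (m - Suc j) @ r"
    using Suc.prems by (cases m) (simp_all add: word_simps)
  have "stack ?A u (ups (Suc m) @ r)"
    using Suc.prems by (intro stack_append[OF A] stack_crs) auto
  moreover have "stack ?B (ups (Suc m) @ r) v"
    using Suc.prems by (intro stack_append[OF _ B] stack_crs) auto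
  ultimately have "mor u (?A @ dots (ups j) (Up # ups (m - Suc j) @ r) @ ?B) v =
    mor u (?A @ [?c (Suc j)] @ dots (ups j @ [Up]) (ups (m - Suc j) @ r) @ [?c (Suc j)] @ ?B) v +
    mor u (?A @ [?c (Suc j)] @ ?B) v"
    unfolding c by (intro mor_dots) (simp_all add: e)
  then show ?case
    using Suc.IH Suc.prems by (simp add: mj word_simps star_def add.assoc)
qed

text \<open>An upward strand to the right of the crossing may be counted with \<open>r\<close> or
  with the strands of the symmetric group.\<close>

lemma crs_Suc_strands:
  "i \<in> {1..<Suc m} \<Longrightarrow> crs (Suc m) (Up # Down # r) i = crs (Suc (Suc m)) (Down # r) i"
  using ups_simps(2)[of "Suc m - i - 1"] by (auto simp: crs_def word_simps Suc_diff_le)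

lemma crs_cup_exchange:
  assumes "set z \<subseteq> {1..<Suc m}"
  shows "heq (ups (Suc m) @ r) (ups (Suc (Suc m)) @ Down # r)
    (map (crs (Suc m) r) z @ [Slice (ups (Suc m)) (Cup Up) r])
    (Slice (ups (Suc m)) (Cup Up) r # map (crs (Suc (Suc m)) (Down # r)) z)"
proof -
  have z: "map (crs (Suc (Suc m)) (Down # r)) z = map (crs (Suc m) (Up # Down # r)) z"
    using assms crs_Suc_strands by auto
  show ?thesis unfolding z
    using heq_whisker[OF heq_exchange_slices[of "map (crs (Suc m) []) z" "ups (Suc m)" "ups (Suc m)"
          "[Slice [] (Cup Up) []]" "[]" "[Up, Down]" "[]"], of "[]" r]
      stack_crs[OF assms, of "[]"]
    by (simp add: o_def whisker_crs word_simps)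
qed

lemma crs_cap_exchange:
  assumes "set z \<subseteq> {1..<Suc m}"
  shows "heq (ups (Suc (Suc m)) @ Down # r) (ups (Suc m) @ r)
    (Slice (ups (Suc m)) (Cap Up) r # map (crs (Suc m) r) z)
    (map (crs (Suc (Suc m)) (Down # r)) z @ [Slice (ups (Suc m)) (Cap Up) r])"
proof -
  have z: "map (crs (Suc (Suc m)) (Down # r)) z = map (crs (Suc m) (Up # Down # r)) z"
    using assms crs_Suc_strands by auto
  show ?thesis unfolding z
    using heq_sym[OF heq_whisker[OF heq_exchange_slices[of "map (crs (Suc m) []) z" "ups (Suc m)"
          "ups (Suc m)" "[Slice [] (Cap Up) []]" "[Up, Down]" "[]" "[]"], of "[]" r]]
      stack_crs[OF assms, of "[]"]
    by (simp add: o_def whisker_crs word_simps)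
qed

lemma lcups_Suc: "lcups (Suc m) = lcups m @ [Slice (ups (Suc m)) (Cup Up) (downs m)]"
  by (simp add: lcups_def cups_def word_simps)

lemma lcaps_Suc: "lcaps (Suc m) = Slice (ups (Suc m)) (Cap Up) (downs m) # lcaps m"
  by (simp add: lcaps_def caps_def word_simps)

text \<open>The curl on the last strand is a crossing closed by a clockwise arc. Lowering its cup
  and raising its cap makes this arc the innermost one of a closure with one more strand.\<close>

lemma closure_last_dot:
  assumes "set y \<subseteq> {1..<Suc m}" "set z \<subseteq> {1..<Suc m}"
  shows "mor [Up] (lcups m @ map (crs (Suc m) (downs m)) (rev z) @ dots (ups m) (downs m) @
      map (crs (Suc m) (downs m)) (rev y) @ lcaps m) [Up] = closure_mor (Suc m) (y @ Suc m # z)"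
proof -
  let ?W = "ups (Suc m) @ downs m" and ?V = "ups (Suc (Suc m)) @ downs (Suc m)"
  let ?c = "crs (Suc m) (downs m)" and ?d = "crs (Suc (Suc m)) (downs (Suc m))"
  let ?P = "Slice (ups (Suc m)) (Cup Up) (downs m)" and ?Q = "Slice (ups (Suc m)) (Cap Up) (downs m)"
  have d: "?d (Suc m) = Slice (ups m) (Cross Up Up) (Down # downs m)"
    by (simp add: crs_def word_simps)
  have m: "stack [?d (Suc m)] ?V ?V" by (simp add: crs_boundary)
  have z: "set (rev z) \<subseteq> {1..<Suc m}" and y: "set (rev y) \<subseteq> {1..<Suc m}" using assms by auto
  have "heq [Up] ?V (lcups m @ map ?c (rev z) @ [?P]) (lcups m @ ?P # map ?d (rev z))"
    using heq_append_left[OF stack_lcups crs_cup_exchange[OF z]] by (simp add: downs_simps(2))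
  moreover have "heq ?V [Up] (?Q # map ?c (rev y) @ lcaps m) (map ?d (rev y) @ ?Q # lcaps m)"
    using heq_append_right[OF crs_cap_exchange[OF y] stack_lcaps] by (simp add: downs_simps(2))
  ultimately have "heq [Up] [Up]
    ((lcups m @ map ?c (rev z) @ [?P]) @ [?d (Suc m)] @ ?Q # map ?c (rev y) @ lcaps m)
    ((lcups m @ ?P # map ?d (rev z)) @ [?d (Suc m)] @ map ?d (rev y) @ ?Q # lcaps m)"
    using m by (meson heq_append heq_refl)
  then show ?thesis
    by (simp add: heq_def closure_mor_def dots_def lcups_Suc lcaps_Suc d ups_simps(2,3))
qed

text \<open>The recursion for powers of the dot: every term is multiplied by one transposition
  involving \<open>1\<close>, and all coefficients are one.\<close>

lemma dot_closure_mor: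
  assumes "set w \<subseteq> {1..<Suc m}"
  shows "dot \<circ>\<^sub>H closure_mor m w =
    (\<Sum>i = 1..m. closure_mor m (star 1 i @ w)) + closure_mor (Suc m) (star 1 (Suc m) @ w)"
proof -
  let ?W = "ups (Suc m) @ downs m" and ?c = "crs (Suc m) (downs m)"
  have A: "stack (lcups m @ map ?c (rev w)) [Up] ?W"
    using assms by (intro stack_append[OF stack_lcups] stack_crs) auto
  \<comment> \<open>The caps lie to the right of the open strand, so the dot can be lowered below
    them.\<close>
  have "heq ?W [Up] (dots [] (ups m @ downs m) @ lcaps m) (lcaps m @ dots [] [])"
    using heq_exchange_slices[OF stack_dots[of "[]" "[]"] stack_caps[of m], of "[]"]
    by (simp add: lcaps_def dots_def ups_simps(2))
  then have "heq [Up] [Up] ((lcups m @ map ?c (rev w)) @ lcaps m @ dots [] [])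
      ((lcups m @ map ?c (rev w)) @ dots [] (ups m @ downs m) @ lcaps m)"
    using A by (intro heq_append_left[OF A]) (rule heq_sym)
  moreover have "dot \<circ>\<^sub>H closure_mor m w =
      mor [Up] ((lcups m @ map ?c (rev w)) @ lcaps m @ dots [] []) [Up]"
    using stack_append[OF A stack_lcaps] stack_dots[of "[]" "[]"]
    by (simp add: closure_mor_def dot_mor mor_comp)
  ultimately have "dot \<circ>\<^sub>H closure_mor m w =
      mor [Up] ((lcups m @ map ?c (rev w)) @ dots [] (ups m @ downs m) @ lcaps m) [Up]"
    by (simp add: heq_def)
  \<comment> \<open>Expanding with \<open>j = m\<close> leaves the dot on the last strand, where
    \<open>closure_last_dot\<close> applies.\<close>
  also have "\<dots> = (\<Sum>i = 1..m. closure_mor m (star 1 i @ w)) +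
      closure_mor (Suc m) ([1..<Suc m] @ Suc m # rev [1..<Suc m] @ w)"
    using mor_dots_expand[OF A stack_lcaps, of m] assms
      closure_last_dot[of "[1..<Suc m]" m "rev [1..<Suc m] @ w"]
    by (simp add: closure_mor_def rev_star ups_simps(1) del: upt_Suc)
  finally show ?thesis by (simp add: star_def)
qed

subsection \<open>Products of transpositions up to conjugation\<close>

lemma comp_transpose_bij: "bij f \<Longrightarrow> f \<circ> transpose x y = transpose (f x) (f y) \<circ> f"
  by (auto simp: fun_eq_iff transpose_def bij_def inj_eq)

lemma word_perm_rev: "word_perm (rev w) = inv (word_perm w)"
proof -
  have "word_perm w \<circ> word_perm (rev w) = id"
  proof (induction w)
    case (Cons i w)
    have "word_perm (i # w) \<circ> word_perm (rev (i # w)) =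
      transpose i (Suc i) \<circ> (word_perm w \<circ> word_perm (rev w)) \<circ> transpose i (Suc i)"
      by (simp only: word_perm_Cons rev.simps word_perm_append word_perm_Nil comp_id comp_assoc)
    then show ?case unfolding Cons by (simp only: comp_id transpose_comp_involutory)
  qed simp
  then show ?thesis by (metis bij_word_perm bij_is_inj inv_o_cancel comp_assoc comp_id id_comp)
qed

lemma word_perm_conjugate:
  "word_perm (v @ [j] @ rev v) = transpose (word_perm v j) (word_perm v (Suc j))"
proof -
  have "word_perm (v @ [j] @ rev v) = word_perm v \<circ> transpose j (Suc j) \<circ> inv (word_perm v)"
    by (simp add: word_perm_rev comp_assoc)
  also have "\<dots> = transpose (word_perm v j) (word_perm v (Suc j)) \<circ> (word_perm v \<circ> inv (word_perm v))"
    by (simp only: comp_transpose_bij[OF bij_word_perm] comp_assoc)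
  finally show ?thesis
    using bij_is_surj[OF bij_word_perm[of v]] by (simp add: surj_iff)
qed

lemma word_perm_star: "a \<le> j \<Longrightarrow> word_perm (star a j) = transpose a (Suc j)"
proof -
  assume a: "a \<le> j"
  \<comment> \<open>The middle letter is conjugated by a run that sends \<open>j\<close> to
    \<open>a\<close> and fixes \<open>Suc j\<close>.\<close>
  have "word_perm [a..<j] (Suc j) = Suc j"
    using permutes_not_in[OF word_perm_permutes[of "[a..<j]" a j]] by simp
  moreover have "star a j = [a..<j] @ [j] @ rev [a..<j]" using a by (simp add: star_def)
  ultimately show ?thesis using word_perm_upt[OF a] word_perm_conjugate by metis
qed

lemma swapidseq_word_perm: "swapidseq (length w) (word_perm w)"
proof (induction w)
  case (Cons i w)
  show ?case unfolding word_perm_Cons length_Cons by (rule swapidseq.comp_Suc[OF Cons]) simp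
qed (simp only: word_perm_Nil list.size swapidseq.id)

lemma swapidseq_conjugate:
  "swapidseq n p \<Longrightarrow> bij f \<Longrightarrow> swapidseq n (f \<circ> p \<circ> inv f)"
proof (induction rule: swapidseq.induct)
  case id
  then show ?case by (metis bij_is_surj surj_iff comp_id swapidseq.id)
next
  case (comp_Suc n p a b)
  have "f \<circ> (transpose a b \<circ> p) \<circ> inv f = transpose (f a) (f b) \<circ> (f \<circ> p \<circ> inv f)"
    using comp_transpose_bij[OF comp_Suc.prems, of a b] by (metis comp_assoc)
  moreover have "f a \<noteq> f b" using comp_Suc by (simp add: bij_is_inj inj_eq)
  ultimately show ?case using swapidseq.comp_Suc comp_Suc by metis
qed

text \<open>Induction on the size of the interval. If \<open>p\<close> moves \<open>a\<close>,
  conjugation fixing \<open>a\<close> makes \<open>Suc a\<close> its image. Splitting off the simple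
  transposition of these two points leaves a permutation fixing \<open>a\<close> that needs one
  transposition fewer.\<close>

lemma swapidseq_conjugate_word:
  assumes "p permutes {a..n}" "swapidseq k p"
  shows "\<exists>v w. set v \<subseteq> {Suc a..<n} \<and> set w \<subseteq> {a..<n} \<and> length w \<le> k \<and>
    word_perm v \<circ> p \<circ> inv (word_perm v) = word_perm w"
  using assms
proof (induction "n - a" arbitrary: a p k)
  case 0
  \<comment> \<open>At most one point is left, so \<open>p\<close> is the identity.\<close>
  then have "{a..n} \<subseteq> {a}" by auto
  then have "p permutes {a}" by (rule permutes_subset[OF 0(2)])
  then have "p = id" by (simp add: permutes_sing)
  then show ?case by (intro exI[of _ "[]"]) simp
next
  case (Suc d)
  have IH: "\<exists>v w. set v \<subseteq> {Suc (Suc a)..<n} \<and> set w \<subseteq> {Suc a..<n} \<and> length w \<le> r \<and>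
    word_perm v \<circ> q \<circ> inv (word_perm v) = word_perm w"
    if "q permutes {a..n}" "q a = a" "swapidseq r q" for q r
  proof (rule Suc.hyps(1))
    show "q permutes {Suc a..n}"
      by (rule permutes_superset[OF that(1)]) (use that(2) in \<open>auto simp: le_Suc_eq not_less_eq_eq\<close>)
  qed (use Suc.hyps(2) that in auto)
  show ?case
  proof (cases "p a = a")
    case True
    then show ?thesis using IH[OF Suc.prems(1) True Suc.prems(2)]
      by (meson atLeastLessThan_iff subset_iff Suc_leD)
  next
    case False
    have "p a \<in> {a..n}" using Suc.prems(1) Suc.hyps(2) by (simp only: permutes_in_image) auto
    with False have b: "Suc a \<le> p a" "p a \<le> n" by auto
    \<comment> \<open>A word exchanging \<open>Suc a\<close> and \<open>p a\<close>;
      \<open>star\<close> denotes a transposition with the successor of its second argument, hence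
      \<open>p a - 1\<close>.\<close>
    define t where "t = (if p a = Suc a then [] else star (Suc a) (p a - 1))"
    have t: "set t \<subseteq> {Suc a..<n}"
      using b False set_star[of "Suc a" "p a - 1" n] by (auto simp: t_def)
    let ?f = "word_perm t"
    have ft: "?f permutes {Suc a..n}" using t by (rule word_perm_permutes)
    have fa: "?f a = a" using permutes_not_in[OF ft] by simp
    have fb: "?f (p a) = Suc a"
      using b False word_perm_star[of "Suc a" "p a - 1"] by (auto simp: t_def)
    define p' where "p' = ?f \<circ> p \<circ> inv ?f"
    define q where "q = transpose a (Suc a) \<circ> p'"
    have "inv ?f a = a" using fa permutes_inverses(2)[OF ft, of a] by simp
    then have p'a: "p' a = Suc a" using fb by (simp add: p'_def)
    have ft': "?f permutes {a..n}" by (rule permutes_subset[OF ft]) auto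
    have p': "p' permutes {a..n}"
      unfolding p'_def by (intro permutes_compose permutes_inv ft' Suc.prems(1))
    have q: "q permutes {a..n}"
      unfolding q_def using Suc.hyps(2) by (intro permutes_compose p' permutes_swap_id) auto
    have qa: "q a = a" using p'a by (simp add: q_def)
    have "swapidseq k p'"
      unfolding p'_def by (rule swapidseq_conjugate[OF Suc.prems(2) bij_word_perm])
    \<comment> \<open>Since \<open>q\<close> fixes \<open>a\<close>, the extra transposition cancels
      one of the \<open>k\<close> factors.\<close>
    then have k: "k \<noteq> 0" and sq: "swapidseq (k - 1) q"
      using fixing_swapidseq_decrease[of k p' a "Suc a"] qa by (auto simp: q_def)
    obtain v w where v: "set v \<subseteq> {Suc (Suc a)..<n}" and w: "set w \<subseteq> {Suc a..<n}" "length w \<le> k - 1"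
      and eq: "word_perm v \<circ> q \<circ> inv (word_perm v) = word_perm w" using IH[OF q qa sq] by blast
    let ?g = "word_perm v"
    have "?g permutes {Suc (Suc a)..n}" using v by (rule word_perm_permutes)
    \<comment> \<open>The second conjugator fixes both points of the split-off transposition and
      therefore commutes with it.\<close>
    then have "?g a = a" "?g (Suc a) = Suc a" by (auto intro: permutes_not_in)
    then have comm: "?g \<circ> transpose a (Suc a) = transpose a (Suc a) \<circ> ?g"
      using comp_transpose_bij[OF bij_word_perm, of v a "Suc a"] by simp
    have pq: "p' = transpose a (Suc a) \<circ> q" by (simp add: q_def flip: comp_assoc)
    have "word_perm (v @ t) \<circ> p \<circ> inv (word_perm (v @ t)) = ?g \<circ> p' \<circ> inv ?g"
      by (simp add: p'_def o_inv_distrib bij_word_perm comp_assoc)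
    also have "\<dots> = transpose a (Suc a) \<circ> (?g \<circ> q \<circ> inv ?g)"
      unfolding pq using comm by (metis comp_assoc)
    finally have "word_perm (v @ t) \<circ> p \<circ> inv (word_perm (v @ t)) = word_perm (a # w)"
      by (simp add: eq)
    moreover have "set (v @ t) \<subseteq> {Suc a..<n}" "set (a # w) \<subseteq> {a..<n}" "length (a # w) \<le> k"
      using v t w k Suc.hyps(2) by auto
    ultimately show ?thesis by blast
  qed
qed

subsection \<open>The expansion of powers of the dot\<close>

inductive_set closure_sums :: "nat \<Rightarrow> heis set" for k where
  zero: "0 \<in> closure_sums k"
| add: "f \<in> closure_sums k \<Longrightarrow> g \<in> closure_sums k \<Longrightarrow> f + g \<in> closure_sums k"
| closure: "m \<le> k \<Longrightarrow> set w \<subseteq> {1..<Suc m} \<Longrightarrow> swapidseq k (word_perm w) \<Longrightarrow>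
    closure_mor m w \<in> closure_sums k"

lemma sum_in_closure_sums:
  "(\<And>x. x \<in> X \<Longrightarrow> f x \<in> closure_sums k) \<Longrightarrow> sum f X \<in> closure_sums k"
  by (induction X rule: infinite_finite_induct) (auto intro: closure_sums.intros)

lemma dot_closure_sums: "f \<in> closure_sums k \<Longrightarrow> dot \<circ>\<^sub>H f \<in> closure_sums (Suc k)"
proof (induction rule: closure_sums.induct)
  case zero
  then show ?case by (simp add: hcomp_zero_right closure_sums.zero)
next
  case (add f g)
  then show ?case by (simp add: hcomp_add_right closure_sums.add)
next
  case (closure m w)
  \<comment> \<open>The bound \<open>m'\<close> treats the terms on the old strands and the term
    with one new strand together.\<close>
  have star: "closure_mor m' (star 1 i @ w) \<in> closure_sums (Suc k)"
    if "1 \<le> i" "i \<le> m'" "m' \<le> Suc k" "m \<le> m'" for i m'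
  proof (rule closure_sums.closure)
    show "set (star 1 i @ w) \<subseteq> {1..<Suc m'}"
      using set_star[of 1 i "Suc m'"] that closure by auto
    show "swapidseq (Suc k) (word_perm (star 1 i @ w))"
      unfolding word_perm_append word_perm_star[OF that(1)]
      using that(1) closure by (intro swapidseq.comp_Suc) auto
  qed (use that in auto)
  show ?case
    unfolding dot_closure_mor[OF closure(2)]
    using closure(1) by (intro closure_sums.add sum_in_closure_sums star) auto
qed

lemma dot_power_closure_sums: "dot_power k \<in> closure_sums k"
proof (induction k)
  case 0
  have "dot_power 0 = closure_mor 0 []"
    by (simp add: closure_mor_def lcups_def lcaps_def cups_def caps_def hid_mor)
  then show ?case using closure_sums.closure[of 0 0 "[]"] by (simp add: swapidseq.id)
next
  case (Suc k)
  then show ?case by (simp add: dot_closure_sums)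
qed

text \<open>The word chosen inside \<open>phi\<close> gives the same permutation as
  \<open>w\<close>, so \<open>closure_mor_cong\<close> identifies the closures.\<close>

lemma partial_closure_phi:
  assumes "set w \<subseteq> {1..<Suc m}"
  shows "partial_closure (Suc m) (phi (Suc m) (word_perm w)) = closure_mor m w"
proof -
  define w' where "w' = (SOME w'. set w' \<subseteq> {1..<Suc m} \<and> word_perm w' = word_perm w)"
  have w': "set w' \<subseteq> {1..<Suc m}" "word_perm w' = word_perm w"
    using someI[of "\<lambda>w'. set w' \<subseteq> {1..<Suc m} \<and> word_perm w' = word_perm w" w] assms
    by (simp_all add: w'_def)
  have "phi (Suc m) (word_perm w) = word_crossings (Suc m) w'"
    by (simp add: phi_def w'_def)
  then show ?thesis
    using partial_closure_word_crossings[OF w'(1)] closure_mor_cong[OF w'(1) assms w'(2)] by simp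
qed

text \<open>The second claim holds because a shortest word is itself a product of transpositions; it
  links Coxeter length to the sign.\<close>

lemma coxeter_length_word_perm:
  assumes "set w \<subseteq> {1..<n}"
  shows "coxeter_length n (word_perm w) \<le> length w"
    and "swapidseq (coxeter_length n (word_perm w)) (word_perm w)"
proof -
  let ?P = "\<lambda>r. \<exists>v. set v \<subseteq> {1..<n} \<and> word_perm v = word_perm w \<and> length v = r"
  have "?P (length w)" using assms by blast
  then show "coxeter_length n (word_perm w) \<le> length w"
    unfolding coxeter_length_def by (rule Least_le)
  from \<open>?P (length w)\<close> have "?P (coxeter_length n (word_perm w))"
    unfolding coxeter_length_def by (rule LeastI)
  then show "swapidseq (coxeter_length n (word_perm w)) (word_perm w)"
    using swapidseq_word_perm by metis
qed

text \<open>A conjugate of small length has the same closure. It is a product both of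
  \<open>k\<close> transpositions and of as many as its Coxeter length, so the parities
  agree.\<close>

lemma closure_mor_eq_partial_closure:
  assumes w: "set w \<subseteq> {1..<Suc m}" and k: "swapidseq k (word_perm w)"
  shows "\<exists>\<sigma>. \<sigma> permutes {1..Suc m} \<and> coxeter_length (Suc m) \<sigma> \<le> k \<and>
    coxeter_length (Suc m) \<sigma> mod 2 = k mod 2 \<and>
    closure_mor m w = partial_closure (Suc m) (phi (Suc m) \<sigma>)"
proof -
  \<comment> \<open>Taking \<open>a = 1\<close> yields a conjugator with letters from
    \<open>2\<close> on, which fixes the open strand.\<close>
  obtain v u where v: "set v \<subseteq> {2..<Suc m}" and u: "set u \<subseteq> {1..<Suc m}" "length u \<le> k"
    and eq: "word_perm v \<circ> word_perm w \<circ> inv (word_perm v) = word_perm u"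
    using swapidseq_conjugate_word[OF word_perm_permutes[OF w] k] by (auto simp: numeral_2_eq_2)
  have "swapidseq k (word_perm u)"
    using swapidseq_conjugate[OF k bij_word_perm, of v] eq by simp
  then have "coxeter_length (Suc m) (word_perm u) mod 2 = k mod 2"
    using swapidseq_even_even[OF coxeter_length_word_perm(2)[OF u(1)]]
    by (metis even_iff_mod_2_eq_zero not_mod_2_eq_0_eq_1)
  moreover have "closure_mor m w = closure_mor m u"
  proof -
    have "closure_mor m w = closure_mor m (v @ w @ rev v)"
      by (rule closure_mor_conjugate[OF v w, symmetric])
    also have "\<dots> = closure_mor m u"
      using v w u eq by (intro closure_mor_cong) (auto simp: word_perm_rev comp_assoc)
    finally show ?thesis .
  qed
  ultimately show ?thesis
    using word_perm_permutes[OF u(1)] coxeter_length_word_perm(1)[OF u(1)] u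
      partial_closure_phi[OF u(1)]
    by (intro exI[of _ "word_perm u"]) simp
qed

text \<open>The claim for an arbitrary morphism in place of the power of the dot, so that it can be
  proved by induction over \<open>closure_sums\<close>.\<close>

definition nat_combination :: "nat \<Rightarrow> heis \<Rightarrow> bool" where
  "nat_combination k f \<longleftrightarrow> (\<exists>m :: nat \<Rightarrow> (nat \<Rightarrow> nat) \<Rightarrow> nat.
    f = (\<Sum>n = 1..k + 1. \<Sum>\<sigma> | \<sigma> permutes {1..n} \<and> coxeter_length n \<sigma> \<le> k.
         of_nat (m n \<sigma>) *\<^sub>H partial_closure n (phi n \<sigma>)) \<and>
    (\<forall>n \<sigma>. 1 \<le> n \<and> n \<le> k + 1 \<and> \<sigma> permutes {1..n} \<and> coxeter_length n \<sigma> \<le> k \<and>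
       coxeter_length n \<sigma> mod 2 \<noteq> k mod 2 \<longrightarrow> m n \<sigma> = 0))"

lemma nat_combination_zero: "nat_combination k 0"
  unfolding nat_combination_def by (rule exI[of _ "\<lambda>_ _. 0"]) (simp add: hscale_zero_left)

lemma nat_combination_add:
  assumes "nat_combination k f" "nat_combination k g"
  shows "nat_combination k (f + g)"
proof -
  obtain m where m: "f = (\<Sum>n = 1..k + 1. \<Sum>\<sigma> | \<sigma> permutes {1..n} \<and> coxeter_length n \<sigma> \<le> k.
         of_nat (m n \<sigma>) *\<^sub>H partial_closure n (phi n \<sigma>))"
    "\<forall>n \<sigma>. 1 \<le> n \<and> n \<le> k + 1 \<and> \<sigma> permutes {1..n} \<and> coxeter_length n \<sigma> \<le> k \<and>
       coxeter_length n \<sigma> mod 2 \<noteq> k mod 2 \<longrightarrow> m n \<sigma> = 0"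
    using assms(1) unfolding nat_combination_def by blast
  obtain m' where m': "g = (\<Sum>n = 1..k + 1. \<Sum>\<sigma> | \<sigma> permutes {1..n} \<and> coxeter_length n \<sigma> \<le> k.
         of_nat (m' n \<sigma>) *\<^sub>H partial_closure n (phi n \<sigma>))"
    "\<forall>n \<sigma>. 1 \<le> n \<and> n \<le> k + 1 \<and> \<sigma> permutes {1..n} \<and> coxeter_length n \<sigma> \<le> k \<and>
       coxeter_length n \<sigma> mod 2 \<noteq> k mod 2 \<longrightarrow> m' n \<sigma> = 0"
    using assms(2) unfolding nat_combination_def by blast
  show ?thesis
    unfolding nat_combination_def
  proof (intro exI conjI)
    show "f + g = (\<Sum>n = 1..k + 1. \<Sum>\<sigma> | \<sigma> permutes {1..n} \<and> coxeter_length n \<sigma> \<le> k.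
         of_nat (m n \<sigma> + m' n \<sigma>) *\<^sub>H partial_closure n (phi n \<sigma>))"
      by (simp only: m(1) m'(1) of_nat_add hscale_add_left sum.distrib)
  qed (use m(2) m'(2) in simp)
qed

lemma nat_combination_partial_closure:
  assumes "1 \<le> n" "n \<le> k + 1" "\<sigma> permutes {1..n}" "coxeter_length n \<sigma> \<le> k"
    "coxeter_length n \<sigma> mod 2 = k mod 2"
  shows "nat_combination k (partial_closure n (phi n \<sigma>))"
proof -
  \<comment> \<open>The indicator of one pair is the witness; its only nonzero coefficient has the
    required parity.\<close>
  let ?m = "\<lambda>n' \<sigma>'. if n' = n \<and> \<sigma>' = \<sigma> then 1 else 0 :: nat"
  let ?F = "partial_closure n (phi n \<sigma>)"
  let ?S = "\<lambda>n'. {\<sigma>'. \<sigma>' permutes {1..n'} \<and> coxeter_length n' \<sigma>' \<le> k}"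
  have fin: "finite (?S n')" for n'
    by (rule finite_subset[OF _ finite_permutations[of "{1..n'}"]]) auto
  have "(\<Sum>\<sigma>'\<in>?S n'. of_nat (?m n' \<sigma>') *\<^sub>H partial_closure n' (phi n' \<sigma>')) =
      (if n' = n then ?F else 0)" for n'
  proof (cases "n' = n")
    case True
    have "(\<Sum>\<sigma>'\<in>?S n'. of_nat (?m n' \<sigma>') *\<^sub>H partial_closure n' (phi n' \<sigma>')) =
        (\<Sum>\<sigma>'\<in>?S n. if \<sigma>' = \<sigma> then ?F else 0)"
      using True by (intro sum.cong) (auto simp: hscale_zero_left hscale_one)
    then show ?thesis using True assms(3,4) fin by (simp add: sum.delta)
  qed (simp add: hscale_zero_left)
  then have "(\<Sum>n' = 1..k + 1. \<Sum>\<sigma>'\<in>?S n'. of_nat (?m n' \<sigma>') *\<^sub>H partial_closure n' (phi n' \<sigma>')) = ?F"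
    using assms(1,2) by (simp add: sum.delta)
  then show ?thesis
    unfolding nat_combination_def using assms(5) by (intro exI[of _ ?m]) auto
qed

lemma nat_combination_closure_sums: "f \<in> closure_sums k \<Longrightarrow> nat_combination k f"
proof (induction rule: closure_sums.induct)
  case (closure m w)
  obtain \<sigma> where "\<sigma> permutes {1..Suc m}" "coxeter_length (Suc m) \<sigma> \<le> k"
    "coxeter_length (Suc m) \<sigma> mod 2 = k mod 2"
    "closure_mor m w = partial_closure (Suc m) (phi (Suc m) \<sigma>)"
    using closure_mor_eq_partial_closure[OF closure(2,3)] by blast
  then show ?case using nat_combination_partial_closure[of "Suc m" k \<sigma>] closure(1) by simp
qed (auto intro: nat_combination_zero nat_combination_add)

theorem theorem5p1:
  fixes k :: nat
  shows "\<exists>m :: nat \<Rightarrow> (nat \<Rightarrow> nat) \<Rightarrow> nat.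
    dot_power k =
      (\<Sum>n = 1..k + 1. \<Sum>\<sigma> | \<sigma> permutes {1..n} \<and> coxeter_length n \<sigma> \<le> k.
         of_nat (m n \<sigma>) *\<^sub>H partial_closure n (phi n \<sigma>)) \<and>
    (\<forall>n \<sigma>. 1 \<le> n \<and> n \<le> k + 1 \<and> \<sigma> permutes {1..n} \<and> coxeter_length n \<sigma> \<le> k \<and>
       coxeter_length n \<sigma> mod 2 \<noteq> k mod 2 \<longrightarrow> m n \<sigma> = 0)"
  using nat_combination_closure_sums[OF dot_power_closure_sums, of k]
  unfolding nat_combination_def .

end
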